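(* There exists a finite constant $C$ such that for any real-valued $\widetilde{F},\widetilde{G}\in\ell^4(\mathbb{Z}^2)$ we have $$\big\|\widetilde{A}_n (\widetilde{F},\widetilde{G})\big\|_{\mathrm{V}_n^2(\mathbb{N},\ell^2(\mathbb{Z}^2))} \leq C \,\|\widetilde{F}\|_{\ell^4(\mathbb{Z}^2)} \|\widetilde{G}\|_{\ell^4(\mathbb{Z}^2)}.$$
   Context: For double sequences $\widetilde{F},\widetilde{G}\colon\mathbb{Z}^2\to\mathbb{R}$, a positive integer $n$ and $(k,l)\in\mathbb{Z}^2$, the discrete averages are $$\widetilde{A}_n(\widetilde{F},\widetilde{G})(k,l) := \frac{1}{n}\sum_{i=0}^{n-1} \widetilde{F}(k+i,l) \,\widetilde{G}(k,l+i).$$ Here $\mathbb{N}=\{1,2,3,\dots\}$. For $1\le\varrho<\infty$, a Banach space $B$, a set $\mathcal{U}\subseteq\mathbb{R}$ and a function $a\colon\mathcal{U}\to B$, the $\varrho$-variation is $$\|a(t)\|_{\mathrm{V}_t^\varrho(\mathcal{U},B)} := \sup_{\substack{m\in\mathbb{N}\cup\{0\}\\ t_0<t_1<\cdots<t_m,\ t_j\in\mathcal{U}}} \Big( \sum_{j=1}^{m} \|a(t_j)-a(t_{j-1})\|_{B}^\varrho \Big)^{1/\varrho}.$$ *)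

theory Defs
  imports "HOL-Analysis.Analysis"
begin

definition lp_space :: "real \<Rightarrow> ('a \<Rightarrow> real) set" where
  "lp_space p = {f. (\<lambda>x. \<bar>f x\<bar> powr p) summable_on UNIV}"

text \<open>Meaningful only on \<^term>\<open>lp_space p\<close>: \<^const>\<open>infsum\<close> is 0 where the sum does not converge.\<close>

definition lp_norm :: "real \<Rightarrow> ('a \<Rightarrow> real) \<Rightarrow> real" where
  "lp_norm p f = (\<Sum>\<^sub>\<infinity>x. \<bar>f x\<bar> powr p) powr (1 / p)"

text \<open>The norm of the Banach space is the parameter \<open>N\<close>, so that spaces of functions such as
  \<^term>\<open>lp_space p\<close> can be used without introducing a type for each of them; \<open>a\<close> is meant to map
  \<open>U\<close> into the space on which \<open>N\<close> is a norm. The value may be infinite.\<close>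

definition variation ::
  "('b::minus \<Rightarrow> real) \<Rightarrow> real \<Rightarrow> 'i::linorder set \<Rightarrow> ('i \<Rightarrow> 'b) \<Rightarrow> ennreal" where
  "variation N \<rho> U a =
     (SUP (m, t) \<in> {(m::nat, t::nat \<Rightarrow> 'i). t ` {..m} \<subseteq> U \<and> strict_mono_on {..m} t}.
        ennreal ((\<Sum>j = 1..m. N (a (t j) - a (t (j - 1))) powr \<rho>) powr (1 / \<rho>)))"

definition discrete_avg ::
  "nat \<Rightarrow> (int \<times> int \<Rightarrow> real) \<Rightarrow> (int \<times> int \<Rightarrow> real) \<Rightarrow> int \<times> int \<Rightarrow> real" where
  "discrete_avg n F G =
     (\<lambda>(k, l). 1 / real n * (\<Sum>i = 0..<n. F (k + int i, l) * G (k, l + int i)))"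

end

theory Submission
  imports Defs "HOL-Library.Discrete_Functions"
begin

text \<open>In the coordinates \<open>F (y, z) = F~(z - y, y)\<close>, \<open>G (x, z) = G~(x, z - x)\<close> the average at \<open>(x, y)\<close> is the mean of the
function \<open>z \<mapsto> F y z * G x z\<close> (the fibre over \<open>(x, y)\<close>) over the window \<open>{x + y ..< x + y + n}\<close>. For one fixed function
on the integers the variation of its window means is bounded by orthogonality. The difficulty is that the fibre and the
window both move with \<open>(x, y)\<close>. All functions are transplanted to a large cyclic group, where sums are finite and
translation invariant, and every scale is a power of two, so that each telescoping below is an exact identity.

The basic positive object is the form \<open>box_form\<close>: four copies of \<open>G\<close> on the corners of a rectangle, with rows
averaged over windows of length \<open>2 ^ l\<close> and columns over windows of length \<open>2 ^ k\<close>. It is a square in the rows and, by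
symmetry, a square in the columns, so it decreases in \<open>l\<close> and in \<open>k\<close>. The decrease in \<open>l\<close> is \<open>haar_form\<close>, in
which row means are replaced by Haar coefficients. Hence a sum of \<open>haar_form\<close> over row scales is at most
\<open>\<Sum> G ^ 4\<close>, even when the column scale increases along the sum (\<open>sum_haar_form_le\<close>).

Let \<open>correlation F G a b \<rho>\<close> be the sum over \<open>(x, y)\<close> of the product of two means of the fibre, of lengths
\<open>2 ^ a\<close> and \<open>2 ^ b\<close>, started at \<open>x + y + \<rho>\<close>. As a function of \<open>\<rho>\<close> it is a superposition of convolutions of a product
of values of \<open>G\<close> with a product of values of \<open>F\<close>. Replacing a tent average of \<open>\<rho>\<close> at scale \<open>2 ^ l\<close> by the tent average at
scale \<open>2 ^ (l + 1)\<close> therefore produces a Haar coefficient of each factor, and Cauchy-Schwarz bounds the change by values of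
\<open>haar_form\<close> for \<open>F\<close> and \<open>G\<close> (\<open>correlation_tent_step\<close>). So the weight that averages the starting point may be changed to
any other scale at a summable cost, provided that its centre of mass relative to the window is kept.

Three consequences finish the proof. Telescoping \<open>correlation F G l l\<close> in \<open>l\<close> bounds the square function made from the Haar
coefficients of the fibres (\<open>sum_tent_haar_square_le\<close>). Expanding a difference of two averages of comparable length
in Haar functions, with geometric decay away from its own scale, reduces the variation inside one dyadic block to this
square function (\<open>single_scale_family_bound\<close>). For a jump from length \<open>2 ^ k\<close> to a much larger \<open>2 ^ K\<close>, the longer
mean is the mean of the shorter ones, so the variance identity turns the squared difference into a difference of
energies \<open>energy F G k - energy F G K\<close>, up to changes of weight (\<open>long_jump\<close>); the energies telescope along the
sequence of jumps. Finally, the bound by \<open>\<Sum> F ^ 4 + \<Sum> G ^ 4\<close> becomes a product by the scaling \<open>F \<mapsto> c F\<close>,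
\<open>G \<mapsto> G / c\<close>, which leaves the averages unchanged.\<close>

section \<open>Dyadic means, Haar coefficients and tent averages on the integers\<close>

text \<open>The mean of \<open>h\<close> over the \<open>2 ^ j\<close> points \<open>p, p + 2 ^ s, p + 2 * 2 ^ s, \<dots>\<close>. The recursion by doubling makes linearity,
Fubini and Jensen one-line inductions and is exactly the structure that the telescoping arguments use.\<close>
primrec dmean :: "nat \<Rightarrow> nat \<Rightarrow> (int \<Rightarrow> real) \<Rightarrow> int \<Rightarrow> real" where
  "dmean s 0 h p = h p"
| "dmean s (Suc j) h p = (dmean s j h p + dmean s j h (p + 2 ^ (s + j))) / 2"

abbreviation mean :: "nat \<Rightarrow> (int \<Rightarrow> real) \<Rightarrow> int \<Rightarrow> real" where
  "mean \<equiv> dmean 0"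

lemma dmean_shift: "dmean s j (\<lambda>x. h (x + c)) p = dmean s j h (p + c)"
  by (induction j arbitrary: p) (simp_all add: algebra_simps)

lemma dmean_const [simp]: "dmean s j (\<lambda>x. c) p = c"
  by (induction j arbitrary: p) simp_all

lemma dmean_add: "dmean s j (\<lambda>x. f x + g x) p = dmean s j f p + dmean s j g p"
  by (induction j arbitrary: p) (simp_all add: field_simps)

lemma dmean_diff: "dmean s j (\<lambda>x. f x - g x) p = dmean s j f p - dmean s j g p"
  by (induction j arbitrary: p) (simp_all add: add_divide_distrib diff_divide_distrib)

lemma dmean_cmult: "dmean s j (\<lambda>x. c * f x) p = c * dmean s j f p"
  by (induction j arbitrary: p) (simp_all add: field_simps)

lemma dmean_multc: "dmean s j (\<lambda>x. f x * c) p = dmean s j f p * c"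
  by (induction j arbitrary: p) (simp_all add: field_simps)

lemma dmean_sum: "dmean s j (\<lambda>x. \<Sum>i\<in>I. f i x) p = (\<Sum>i\<in>I. dmean s j (f i) p)"
proof (induction j arbitrary: p)
  case (Suc j)
  then show ?case by (simp add: sum.distrib sum_divide_distrib add_divide_distrib)
qed simp

lemma dmean_mono_local:
  assumes "\<And>x. p \<le> x \<Longrightarrow> x < p + 2 ^ (s + j) \<Longrightarrow> f x \<le> g x"
  shows "dmean s j f p \<le> dmean s j g p"
  using assms
proof (induction j arbitrary: p)
  case (Suc j)
  have "dmean s j f p \<le> dmean s j g p"
    by (rule Suc.IH, rule Suc.prems) auto
  moreover have "dmean s j f (p + 2 ^ (s + j)) \<le> dmean s j g (p + 2 ^ (s + j))"
    by (rule Suc.IH, rule Suc.prems) (auto intro: add_increasing2 order_trans[rotated])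
  ultimately show ?case by simp
qed simp

lemma dmean_mono: "(\<And>x. f x \<le> g x) \<Longrightarrow> dmean s j f p \<le> dmean s j g p"
  by (rule dmean_mono_local)

lemma dmean_nonneg: "(\<And>x. 0 \<le> f x) \<Longrightarrow> 0 \<le> dmean s j f p"
  using dmean_mono[of "\<lambda>_. 0" f s j p] by simp

lemma dmean_abs_le: "\<bar>dmean s j f p\<bar> \<le> dmean s j (\<lambda>x. \<bar>f x\<bar>) p"
proof (induction j arbitrary: p)
  case (Suc j)
  show ?case using Suc[of p] Suc[of "p + 2 ^ (s + j)"] by simp
qed simp

lemma dmean_swap:
  "dmean s j (\<lambda>x. dmean s' j' (h x) q) p = dmean s' j' (\<lambda>y. dmean s j (\<lambda>x. h x y) p) q"
proof (induction j arbitrary: p)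
  case (Suc j)
  have "dmean s' j' (\<lambda>y. dmean s (Suc j) (\<lambda>x. h x y) p) q
      = dmean s' j' (\<lambda>y. (1/2) * (dmean s j (\<lambda>x. h x y) p + dmean s j (\<lambda>x. h x y) (p + 2 ^ (s + j)))) q"
    by simp
  also have "\<dots> = (1/2) * (dmean s' j' (\<lambda>y. dmean s j (\<lambda>x. h x y) p) q
       + dmean s' j' (\<lambda>y. dmean s j (\<lambda>x. h x y) (p + 2 ^ (s + j))) q)"
    by (simp only: dmean_cmult dmean_add)
  finally show ?case by (simp add: Suc)
qed simp

lemma dmean_mult:
  "dmean s j f p * dmean s' j' g q = dmean s j (\<lambda>x. dmean s' j' (\<lambda>y. f x * g y) q) p"
  by (simp add: dmean_cmult dmean_multc)

lemma dmean_comp: "dmean s (i + j) h p = dmean (s + i) j (dmean s i h) p"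
  by (induction j arbitrary: p) (simp_all add: add.assoc)

lemma dmean_jensen: "(dmean s j h p)\<^sup>2 \<le> dmean s j (\<lambda>x. (h x)\<^sup>2) p"
proof (induction j arbitrary: p)
  case (Suc j)
  have "((a + b) / 2)\<^sup>2 \<le> (a\<^sup>2 + b\<^sup>2) / 2" for a b :: real
    using zero_le_power2[of "a - b"] by (simp add: power2_eq_square field_simps)
  from this[of "dmean s j h p" "dmean s j h (p + 2 ^ (s + j))"]
  show ?case using Suc[of p] Suc[of "p + 2 ^ (s + j)"] by simp
qed simp

text \<open>Cauchy-Schwarz for the measure with density \<open>\<bar>f\<bar>\<close>, by the discriminant of a nonnegative quadratic in \<open>t\<close>.\<close>
lemma dmean_cauchy_schwarz:
  "(dmean s j (\<lambda>x. f x * g x) p)\<^sup>2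
     \<le> dmean s j (\<lambda>x. \<bar>f x\<bar>) p * dmean s j (\<lambda>x. \<bar>f x\<bar> * (g x)\<^sup>2) p"
proof -
  let ?a = "dmean s j (\<lambda>x. \<bar>f x\<bar>) p" and ?b = "dmean s j (\<lambda>x. f x * g x) p"
  and ?c = "dmean s j (\<lambda>x. \<bar>f x\<bar> * (g x)\<^sup>2) p"
  have q: "0 \<le> t\<^sup>2 * ?a - 2 * t * ?b + ?c" for t
  proof -
    have "0 \<le> dmean s j (\<lambda>x. t\<^sup>2 * \<bar>f x\<bar> - 2 * t * (f x * g x) + \<bar>f x\<bar> * (g x)\<^sup>2) p"
    proof (rule dmean_nonneg)
      fix x
      have "2 * t * (f x * g x) \<le> \<bar>f x\<bar> * (2 * \<bar>t\<bar> * \<bar>g x\<bar>)"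
        using abs_ge_self[of "2 * t * (f x * g x)"] by (simp add: abs_mult mult_ac)
      also have "\<dots> \<le> \<bar>f x\<bar> * (t\<^sup>2 + (g x)\<^sup>2)"
        using zero_le_power2[of "\<bar>t\<bar> - \<bar>g x\<bar>"]
        by (intro mult_left_mono) (auto simp: power2_diff)
      finally show "0 \<le> t\<^sup>2 * \<bar>f x\<bar> - 2 * t * (f x * g x) + \<bar>f x\<bar> * (g x)\<^sup>2"
        by (simp add: algebra_simps)
    qed
    then show ?thesis by (simp only: dmean_add dmean_diff dmean_cmult)
  qed
  have a0: "0 \<le> ?a" by (rule dmean_nonneg) simp
  show ?thesis
  proof (cases "?a = 0")
    case True
    have c0: "0 \<le> ?c" by (rule dmean_nonneg) simp
    have "?b = 0"
    proof (rule ccontr)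
      assume "?b \<noteq> 0"
      with q[of "(?c + 1) / ?b"] True c0 show False by simp
    qed
    then show ?thesis using True by simp
  next
    case False
    then have "0 < ?a" using a0 by simp
    from q[of "?b / ?a"] False have "0 \<le> ?c - ?b\<^sup>2 / ?a"
      by (simp add: power2_eq_square)
    then show ?thesis using \<open>0 < ?a\<close> by (simp add: field_simps)
  qed
qed

lemma mean_eq_sum: "mean j h p = (\<Sum>i\<in>{p..<p + 2 ^ j}. h i) / 2 ^ j"
proof (induction j arbitrary: p)
  case 0
  have "{p..<p+1} = {p}" by auto
  then show ?case by simp
next
  case (Suc j)
  have "{p..<p + 2 ^ Suc j} = {p..<p + 2 ^ j} \<union> {p + 2 ^ j..<p + 2 ^ j + 2 ^ j}"
    using zero_less_power[of "2::int" j] by (auto simp: not_less)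
  then have "sum h {p..<p + 2 ^ Suc j} = sum h {p..<p + 2 ^ j} + sum h {p + 2 ^ j..<p + 2 ^ j + 2 ^ j}"
    by (simp add: sum.union_disjoint)
  then show ?case by (simp add: Suc field_simps)
qed

lemma mean_window_le:
  assumes "\<And>x. 0 \<le> h x" "q \<le> p" "p + 2 ^ i \<le> q + 2 ^ j"
  shows "2 ^ i * mean i h p \<le> 2 ^ j * mean j h q"
proof -
  have "(\<Sum>i\<in>{p..<p + 2 ^ i}. h i) \<le> (\<Sum>i\<in>{q..<q + 2 ^ j}. h i)"
    using assms by (intro sum_mono2) auto
  then show ?thesis by (simp add: mean_eq_sum)
qed

definition haar :: "nat \<Rightarrow> (int \<Rightarrow> real) \<Rightarrow> int \<Rightarrow> real" where
  "haar l h p = (mean l h p - mean l h (p + 2 ^ l)) / 2"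

text \<open>The exact loss of energy when the length of a mean is doubled; this is the source of every telescoping sum below.\<close>
lemma haar_parallelogram:
  "(mean (Suc l) h p)\<^sup>2 + (haar l h p)\<^sup>2 = ((mean l h p)\<^sup>2 + (mean l h (p + 2 ^ l))\<^sup>2) / 2"
  by (simp add: haar_def power2_eq_square field_simps)

text \<open>The Haar basis of a window of length \<open>2 ^ L\<close>: a pairing splits over the scales \<open>l < L\<close>, with Haar coefficients only at
the aligned positions \<open>q + 2 ^ (l + 1) * i\<close>, plus the product of the total means. The induction glues two adjacent windows.\<close>
lemma haar_expansion:
  "mean L (\<lambda>z. \<phi> z * f z) q
     = (\<Sum>l<L. dmean (Suc l) (L - Suc l) (\<lambda>p. haar l \<phi> p * haar l f p) q) + mean L \<phi> q * mean L f q"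
proof (induction L arbitrary: q)
  case (Suc L)
  let ?D = "\<lambda>l. dmean (Suc l) (L - Suc l) (\<lambda>p. haar l \<phi> p * haar l f p)"
  have step: "(?D l q + ?D l (q + 2 ^ L)) / 2
      = dmean (Suc l) (Suc L - Suc l) (\<lambda>p. haar l \<phi> p * haar l f p) q" if "l < L" for l
  proof -
    have "Suc L - Suc l = Suc (L - Suc l)" "Suc l + (L - Suc l) = L" using that by auto
    then show ?thesis by simp
  qed
  have "mean (Suc L) (\<lambda>z. \<phi> z * f z) q = (\<Sum>l<L. (?D l q + ?D l (q + 2 ^ L)) / 2)
     + (mean L \<phi> q * mean L f q + mean L \<phi> (q + 2 ^ L) * mean L f (q + 2 ^ L)) / 2"
    by (simp add: Suc sum.distrib sum_divide_distrib[symmetric] add_divide_distrib)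
  also have "(\<Sum>l<L. (?D l q + ?D l (q + 2 ^ L)) / 2)
     = (\<Sum>l<L. dmean (Suc l) (Suc L - Suc l) (\<lambda>p. haar l \<phi> p * haar l f p) q)"
    by (rule sum.cong) (use step in auto)
  also have "(mean L \<phi> q * mean L f q + mean L \<phi> (q + 2 ^ L) * mean L f (q + 2 ^ L)) / 2
     = haar L \<phi> q * haar L f q + mean (Suc L) \<phi> q * mean (Suc L) f q"
    by (simp add: haar_def field_simps)
  finally show ?case by simp
qed simp

text \<open>The average against the tent (Fejer) kernel of width \<open>2 ^ l\<close> centred at \<open>c\<close>. As the autocorrelation of an interval
it is a positive definite weight, and the difference of two consecutive tents is an autocorrelation of a Haar function.\<close>
definition tent :: "nat \<Rightarrow> (int \<Rightarrow> real) \<Rightarrow> int \<Rightarrow> real" where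
  "tent l \<phi> c = mean l (mean l \<phi>) (c - 2 ^ l + 1)"

lemma tent_0 [simp]: "tent 0 \<phi> c = \<phi> c"
  by (simp add: tent_def)

lemma mean_halves: "dmean s j (\<lambda>x. (f x + g x) / 2) p = (dmean s j f p + dmean s j g p) / 2"
  using dmean_cmult[of s j "1/2" "\<lambda>x. f x + g x" p] by (simp add: dmean_add)

lemma tent_Suc:
  "tent (Suc l) \<phi> c = (2 * tent l \<phi> c + tent l \<phi> (c + 2 ^ l) + tent l \<phi> (c - 2 ^ l)) / 4"
proof -
  have *: "mean l (\<lambda>x. mean (Suc l) \<phi> x) p = (mean l (mean l \<phi>) p + mean l (mean l \<phi>) (p + 2 ^ l)) / 2" for p
    by (simp add: mean_halves dmean_shift)
  have "tent (Suc l) \<phi> c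
     = (mean l (mean (Suc l) \<phi>) (c - 2 ^ Suc l + 1) + mean l (mean (Suc l) \<phi>) (c - 2 ^ Suc l + 1 + 2 ^ l)) / 2"
    unfolding tent_def by simp
  also have "\<dots> = (2 * tent l \<phi> c + tent l \<phi> (c + 2 ^ l) + tent l \<phi> (c - 2 ^ l)) / 4"
    unfolding * tent_def by (simp add: algebra_simps add_divide_distrib)
  finally show ?thesis .
qed

lemma tent_const [simp]: "tent l (\<lambda>x. a) c = a"
proof -
  have "mean l (\<lambda>x. a) = (\<lambda>x. a)" by (rule ext) simp
  then show ?thesis by (simp add: tent_def)
qed

lemma tent_add: "tent l (\<lambda>x. f x + g x) c = tent l f c + tent l g c"
proof -
  have "mean l (\<lambda>x. f x + g x) = (\<lambda>x. mean l f x + mean l g x)" by (rule ext) (rule dmean_add)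
  then show ?thesis by (simp add: tent_def dmean_add)
qed

lemma tent_diff: "tent l (\<lambda>x. f x - g x) c = tent l f c - tent l g c"
proof -
  have "mean l (\<lambda>x. f x - g x) = (\<lambda>x. mean l f x - mean l g x)" by (rule ext) (rule dmean_diff)
  then show ?thesis by (simp add: tent_def dmean_diff)
qed

lemma tent_cmult: "tent l (\<lambda>x. a * f x) c = a * tent l f c"
proof -
  have "mean l (\<lambda>x. a * f x) = (\<lambda>x. a * mean l f x)" by (rule ext) (rule dmean_cmult)
  then show ?thesis by (simp add: tent_def dmean_cmult)
qed

lemma tent_shift: "tent l (\<lambda>x. f (x + a)) c = tent l f (c + a)"
proof -
  have "mean l (\<lambda>x. f (x + a)) = (\<lambda>x. mean l f (x + a))" by (rule ext) (rule dmean_shift)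
  then show ?thesis by (simp add: tent_def dmean_shift algebra_simps)
qed

lemma tent_dmean: "dmean s j (tent l f) c = tent l (dmean s j f) c"
proof (induction j arbitrary: c)
  case (Suc j)
  have "tent l (dmean s (Suc j) f) c = tent l (\<lambda>x. (1/2) * (dmean s j f x + dmean s j f (x + 2 ^ (s + j)))) c"
    by (rule arg_cong[where f = "\<lambda>h. tent l h c"]) auto
  also have "\<dots> = (1/2) * (tent l (dmean s j f) c + tent l (dmean s j f) (c + 2 ^ (s + j)))"
    by (simp only: tent_cmult tent_add tent_shift)
  finally have e: "tent l (dmean s (Suc j) f) c
      = (1/2) * (tent l (dmean s j f) c + tent l (dmean s j f) (c + 2 ^ (s + j)))" .
  show ?case unfolding e dmean.simps(2)[of s j "tent l f" c] Suc by simp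
next
  case 0
  have "dmean s 0 f = f" by (rule ext) simp
  then show ?case by simp
qed

lemma tent_mono_local:
  assumes "\<And>x. c - 2 ^ l < x \<Longrightarrow> x < c + 2 ^ l \<Longrightarrow> f x \<le> g x"
  shows "tent l f c \<le> tent l g c"
  unfolding tent_def
  by (intro dmean_mono_local assms) auto

lemma tent_mono: "(\<And>x. f x \<le> g x) \<Longrightarrow> tent l f c \<le> tent l g c"
  by (rule tent_mono_local)

lemma tent_nonneg: "(\<And>x. 0 \<le> f x) \<Longrightarrow> 0 \<le> tent l f c"
  using tent_mono[of "\<lambda>_. 0" f l c] by simp

text \<open>A wider tent is a convex combination of translates of the tent of width \<open>2 ^ l\<close>, for which the second difference at
step \<open>2 ^ l\<close> is a multiple of the difference of consecutive tents by \<open>tent_Suc\<close>.\<close>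
lemma tent_second_difference:
  assumes B: "\<And>c. \<bar>tent l \<phi> c - tent (Suc l) \<phi> c\<bar> \<le> B" and "l \<le> L"
  shows "\<bar>tent L \<phi> c - (tent L \<phi> (c - 2 ^ l) + tent L \<phi> (c + 2 ^ l)) / 2\<bar> \<le> 2 * B"
  using \<open>l \<le> L\<close>
proof (induction L arbitrary: c rule: dec_induct)
  case base
  show ?case using B[of c] unfolding tent_Suc by (simp add: abs_le_iff field_simps)
next
  case (step n)
  have "\<bar>(2 * a + b + d) / 4\<bar> \<le> 2 * B" if "\<bar>a\<bar> \<le> 2 * B" "\<bar>b\<bar> \<le> 2 * B" "\<bar>d\<bar> \<le> 2 * B" for a b d :: real
    using that unfolding abs_le_iff by (auto simp: field_simps)
  from this[OF step.IH[of c] step.IH[of "c + 2 ^ n"] step.IH[of "c - 2 ^ n"]]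
  show ?case by (simp add: tent_Suc algebra_simps add_divide_distrib diff_divide_distrib)
qed

text \<open>A window mean of length \<open>2 ^ k\<close> has its centre \<open>2 ^ (k - 1)\<close> to the right of its starting point, so the neutral weight
for the starting point is the tent centred at \<open>- (2 ^ (k - 1))\<close>. Cutting a window of length \<open>2 ^ (k + j)\<close> into pieces of
length \<open>2 ^ k\<close> averages the weight over the starting points of the pieces. Because the centres of mass agree, passing from one
scale to the next involves only second differences, which are controlled by the hypothesis.\<close>
lemma tent_recentre:
  assumes B: "\<And>l c. \<bar>tent l \<phi> c - tent (Suc l) \<phi> c\<bar> \<le> B l" and k: "1 \<le> k"
  shows "\<bar>dmean k j (tent (k + j) \<phi>) (- (2 ^ (k + j - 1))) - tent k \<phi> (- (2 ^ (k - 1)))\<bar>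
     \<le> (\<Sum>l\<in>{k..<k + j}. B l + 2 * B (l - 1))"
proof (induction j)
  case 0
  then show ?case by simp
next
  case (Suc j)
  let ?l = "k + j" and ?t = "2 ^ (k + j - 1) :: int"
  have t2: "2 * ?t = 2 ^ ?l" using k by (cases k) auto
  define P where "P = tent (Suc ?l) \<phi>"
  have "dmean k (Suc j) P (- (2 ^ ?l)) = (dmean k j P (- ?t - ?t) + dmean k j P (- ?t + ?t)) / 2"
    using t2 by (simp add: algebra_simps)
  also have "\<dots> = dmean k j (\<lambda>c. (P (c - ?t) + P (c + ?t)) / 2) (- ?t)"
    using dmean_shift[of k j P "-?t" "-?t"] dmean_shift[of k j P "?t" "-?t"]
    by (simp add: mean_halves)
  finally have e: "dmean k (Suc j) P (- (2 ^ ?l)) = dmean k j (\<lambda>c. (P (c - ?t) + P (c + ?t)) / 2) (- ?t)" .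
  have pt: "\<bar>tent ?l \<phi> c - (P (c - ?t) + P (c + ?t)) / 2\<bar> \<le> B ?l + 2 * B (?l - 1)" for c
  proof -
    have "\<bar>P c - (P (c - ?t) + P (c + ?t)) / 2\<bar> \<le> 2 * B (?l - 1)"
      unfolding P_def by (rule tent_second_difference[OF B]) simp
    then show ?thesis using B[of ?l c] unfolding P_def by linarith
  qed
  have "\<bar>dmean k j (tent ?l \<phi>) (- ?t) - dmean k (Suc j) P (- (2 ^ ?l))\<bar>
      = \<bar>dmean k j (\<lambda>c. tent ?l \<phi> c - (P (c - ?t) + P (c + ?t)) / 2) (- ?t)\<bar>"
    unfolding e by (simp only: dmean_diff)
  also have "\<dots> \<le> dmean k j (\<lambda>c. \<bar>tent ?l \<phi> c - (P (c - ?t) + P (c + ?t)) / 2\<bar>) (- ?t)"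
    by (rule dmean_abs_le)
  also have "\<dots> \<le> dmean k j (\<lambda>c. B ?l + 2 * B (?l - 1)) (- ?t)"
    by (rule dmean_mono) (rule pt)
  finally have "\<bar>dmean k j (tent ?l \<phi>) (- ?t) - dmean k (Suc j) P (- (2 ^ ?l))\<bar> \<le> B ?l + 2 * B (?l - 1)"
    by simp
  then have "\<bar>dmean k j (tent ?l \<phi>) (- ?t) - dmean k (Suc j) (tent (k + Suc j) \<phi>) (- (2 ^ (k + Suc j - 1)))\<bar>
      \<le> B ?l + 2 * B (?l - 1)"
    unfolding P_def by (simp del: dmean.simps)
  moreover have "(\<Sum>l\<in>{k..<k + Suc j}. B l + 2 * B (l - 1))
      = (\<Sum>l\<in>{k..<k + j}. B l + 2 * B (l - 1)) + (B ?l + 2 * B (?l - 1))"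
    by simp
  ultimately show ?case using Suc by linarith
qed

lemma mean_le_tent:
  assumes \<phi>: "\<And>x. 0 \<le> \<phi> x" and q: "c - 2 ^ (i + 1) \<le> q" "q + 2 ^ i \<le> c + 1 + 2 ^ i"
  shows "mean i \<phi> q \<le> 16 * tent (i + 2) \<phi> c"
proof -
  let ?R = "i + 2" and ?p = "c - 2 ^ (i + 2) + 1"
  have low: "mean i \<phi> q / 4 \<le> mean ?R \<phi> \<alpha>"
    if "?p + 2 ^ i \<le> \<alpha>" "\<alpha> < ?p + 2 ^ i + 2 ^ i" for \<alpha>
  proof -
    have "2 ^ i * mean i \<phi> q \<le> 2 ^ ?R * mean ?R \<phi> \<alpha>"
      using that q by (intro mean_window_le \<phi>) auto
    then show ?thesis by (simp del: dmean.simps add: power_add)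
  qed
  have "mean i \<phi> q / 4 \<le> mean i (mean ?R \<phi>) (?p + 2 ^ i)"
    using dmean_mono_local[of "?p + 2 ^ i" 0 i "\<lambda>_. mean i \<phi> q / 4" "mean ?R \<phi>"] low by simp
  moreover have "2 ^ i * mean i (mean ?R \<phi>) (?p + 2 ^ i) \<le> 2 ^ ?R * mean ?R (mean ?R \<phi>) ?p"
    by (intro mean_window_le dmean_nonneg \<phi>) auto
  ultimately show ?thesis by (simp del: dmean.simps add: tent_def power_add)
qed

section \<open>Cyclic sums and the rectangle form\<close>

text \<open>Functions on the cyclic group of order \<open>M\<close> are modelled as \<open>M\<close>-periodic functions on the integers. Sums over one
period are finite, so that only translation and reflection invariance need periodicity.\<close>
locale cyclic_sum =
  fixes M :: int
  assumes M_pos: "0 < M"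
begin

definition csum :: "(int \<Rightarrow> real) \<Rightarrow> real" where
  "csum f = (\<Sum>x\<in>{0..<M}. f x)"

definition periodic :: "(int \<Rightarrow> 'b) \<Rightarrow> bool" where
  "periodic f \<longleftrightarrow> (\<forall>x. f (x + M) = f x)"

definition biperiodic :: "(int \<Rightarrow> int \<Rightarrow> real) \<Rightarrow> bool" where
  "biperiodic G \<longleftrightarrow> periodic G \<and> (\<forall>x. periodic (G x))"

lemma periodicI: "(\<And>x. f (x + M) = f x) \<Longrightarrow> periodic f"
  by (simp add: periodic_def)

lemma periodicD: "periodic f \<Longrightarrow> f (x + M) = f x"
  by (simp add: periodic_def)

lemma periodic_shift:
  assumes "periodic f" shows "periodic (\<lambda>x. f (x + c))"
proof (rule periodicI)
  fix x show "f (x + M + c) = f (x + c)"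
    using periodicD[OF assms, of "x + c"] by (simp only: ac_simps)
qed

lemma periodic_reflect:
  assumes "periodic f" shows "periodic (\<lambda>x. f (c - x))"
proof (rule periodicI)
  fix x show "f (c - (x + M)) = f (c - x)"
    using periodicD[OF assms, of "c - (x + M)"] by (simp add: algebra_simps)
qed

lemma periodic_dmean: "periodic f \<Longrightarrow> periodic (dmean s j f)"
  by (rule periodicI) (simp add: dmean_shift[symmetric] periodicD)

lemma periodic_haar: "periodic f \<Longrightarrow> periodic (haar l f)"
  by (rule periodicI) (simp add: haar_def periodicD[OF periodic_dmean] periodicD[OF periodic_shift[OF periodic_dmean]])

lemma csum_shift:
  assumes "periodic f" shows "csum (\<lambda>x. f (x + c)) = csum f"
proof -
  have st: "(\<Sum>x\<in>{a + 1..<a + 1 + M}. f x) = (\<Sum>x\<in>{a..<a + M}. f x)" for a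
  proof -
    have "{a..<a + M} = insert a {a + 1..<a + M}" "{a + 1..<a + 1 + M} = insert (a + M) {a + 1..<a + M}"
      using M_pos by auto
    then show ?thesis using periodicD[OF assms, of a] by simp
  qed
  have "(\<Sum>x\<in>{a..<a + M}. f x) = csum f" for a
  proof (induction a rule: int_induct[where k = 0])
    case base then show ?case by (simp add: csum_def)
  next
    case (step1 i) then show ?case using st[of i] by simp
  next
    case (step2 i) then show ?case using st[of "i - 1"] by simp
  qed
  moreover have "csum (\<lambda>x. f (x + c)) = (\<Sum>x\<in>{c..<c + M}. f x)"
    unfolding csum_def by (rule sum.reindex_bij_witness[of _ "\<lambda>x. x - c" "\<lambda>x. x + c"]) auto
  ultimately show ?thesis by simp
qed

lemma csum_reflect:
  assumes "periodic f" shows "csum (\<lambda>x. f (c - x)) = csum f"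
proof -
  have "csum (\<lambda>x. f (c - x)) = csum (\<lambda>x. f (x + (c - M + 1)))"
    unfolding csum_def by (rule sum.reindex_bij_witness[of _ "\<lambda>x. M - 1 - x" "\<lambda>x. M - 1 - x"])
      (auto simp: algebra_simps)
  then show ?thesis using csum_shift[OF assms] by simp
qed

lemma csum_add: "csum (\<lambda>x. f x + g x) = csum f + csum g" by (simp add: csum_def sum.distrib)
lemma csum_diff: "csum (\<lambda>x. f x - g x) = csum f - csum g" by (simp add: csum_def sum_subtractf)
lemma csum_cmult: "csum (\<lambda>x. c * f x) = c * csum f" by (simp add: csum_def sum_distrib_left)
lemma csum_divide: "csum (\<lambda>x. f x / c) = csum f / c" by (simp add: csum_def sum_divide_distrib)
lemma csum_sum: "csum (\<lambda>x. \<Sum>i\<in>I. f i x) = (\<Sum>i\<in>I. csum (f i))"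
  unfolding csum_def by (rule sum.swap)
lemma csum_swap: "csum (\<lambda>x. csum (f x)) = csum (\<lambda>y. csum (\<lambda>x. f x y))"
  unfolding csum_def by (rule sum.swap)
lemma csum_mono: "(\<And>x. f x \<le> g x) \<Longrightarrow> csum f \<le> csum g" by (simp add: csum_def sum_mono)
lemma csum_nonneg: "(\<And>x. 0 \<le> f x) \<Longrightarrow> 0 \<le> csum f" by (simp add: csum_def sum_nonneg)
lemma csum_abs: "\<bar>csum f\<bar> \<le> csum (\<lambda>x. \<bar>f x\<bar>)" by (simp add: csum_def)
lemma csum_cong: "(\<And>x. f x = g x) \<Longrightarrow> csum f = csum g" by (simp add: csum_def)
lemma csum_dmean: "csum (\<lambda>x. dmean s j (h x) p) = dmean s j (\<lambda>y. csum (\<lambda>x. h x y)) p"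
  by (simp add: csum_def dmean_sum)
lemma csum_tent: "csum (\<lambda>x. tent l (h x) p) = tent l (\<lambda>y. csum (\<lambda>x. h x y)) p"
proof -
  have "mean l (\<lambda>y. csum (\<lambda>x. h x y)) = (\<lambda>p. csum (\<lambda>x. mean l (h x) p))"
    by (rule ext) (rule csum_dmean[symmetric])
  then show ?thesis by (simp add: tent_def csum_dmean)
qed

lemma csum_dmean_periodic: "periodic f \<Longrightarrow> csum (dmean s j f) = csum f"
proof -
  assume f: "periodic f"
  have "csum (dmean s j f) = csum (\<lambda>x. dmean s j (\<lambda>i. f (x + i)) 0)"
  proof (rule csum_cong)
    fix x
    show "dmean s j f x = dmean s j (\<lambda>i. f (x + i)) 0"
      using dmean_shift[of s j f x 0] by (simp only: add.commute[of x] add_0)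
  qed
  also have "\<dots> = dmean s j (\<lambda>i. csum (\<lambda>x. f (x + i))) 0" by (rule csum_dmean)
  finally show ?thesis by (simp add: csum_shift[OF f])
qed

definition norm4 :: "(int \<Rightarrow> int \<Rightarrow> real) \<Rightarrow> real" where
  "norm4 G = csum (\<lambda>x. csum (\<lambda>z. (G x z) ^ 4))"

definition col_product :: "(int \<Rightarrow> int \<Rightarrow> real) \<Rightarrow> int \<Rightarrow> int \<Rightarrow> int \<Rightarrow> real" where
  "col_product G z z' x = G x z * G x z'"

text \<open>Expanding the square gives the sum over rectangles of \<open>G\<close> at the four corners, with side lengths averaged at the scales
\<open>l\<close> (rows) and \<open>k\<close> (columns).\<close>
definition box_form :: "(int \<Rightarrow> int \<Rightarrow> real) \<Rightarrow> nat \<Rightarrow> nat \<Rightarrow> real" where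
  "box_form G l k = csum (\<lambda>p. mean k (\<lambda>z. mean k (\<lambda>z'. csum (\<lambda>q. (mean l (col_product G z z') q)\<^sup>2)) p) p)"

text \<open>Two column scales are allowed because the products of means of different lengths that occur for long jumps
lead to columns averaged at different scales.\<close>
definition haar_form :: "(int \<Rightarrow> int \<Rightarrow> real) \<Rightarrow> nat \<Rightarrow> nat \<Rightarrow> nat \<Rightarrow> real" where
  "haar_form G l a b = csum (\<lambda>p. mean a (\<lambda>z. mean b (\<lambda>z'. csum (\<lambda>q. (haar l (col_product G z z') q)\<^sup>2)) p) p)"

lemma periodic_col_product: "biperiodic G \<Longrightarrow> periodic (col_product G z z')"
  by (auto simp: biperiodic_def periodic_def col_product_def)

lemma biperiodic_col_product: "biperiodic G \<Longrightarrow> periodic (col_product G)" "biperiodic G \<Longrightarrow> periodic (col_product G z)"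
  by (auto simp: biperiodic_def periodic_def col_product_def fun_eq_iff)

lemma haar_form_nonneg: "0 \<le> haar_form G l a b"
  unfolding haar_form_def by (intro csum_nonneg dmean_nonneg) auto

lemma box_form_nonneg: "0 \<le> box_form G l k"
  unfolding box_form_def by (intro csum_nonneg dmean_nonneg) auto

text \<open>The parallelogram identity, summed over all positions.\<close>
lemma box_form_step:
  assumes G: "biperiodic G" shows "box_form G (Suc l) k + haar_form G l k k = box_form G l k"
proof -
  have "csum (\<lambda>q. (mean (Suc l) g q)\<^sup>2) + csum (\<lambda>q. (haar l g q)\<^sup>2) = csum (\<lambda>q. (mean l g q)\<^sup>2)"
    if g: "periodic g" for g
  proof -
    have p: "periodic (\<lambda>q. (mean l g q)\<^sup>2)" using periodic_dmean[OF g, of 0 l] by (auto simp: periodic_def)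
    have "csum (\<lambda>q. (mean (Suc l) g q)\<^sup>2) + csum (\<lambda>q. (haar l g q)\<^sup>2)
       = csum (\<lambda>q. (mean (Suc l) g q)\<^sup>2 + (haar l g q)\<^sup>2)" by (rule csum_add[symmetric])
    also have "\<dots> = csum (\<lambda>q. ((mean l g q)\<^sup>2 + (mean l g (q + 2 ^ l))\<^sup>2) / 2)"
      by (simp only: haar_parallelogram)
    also have "\<dots> = csum (\<lambda>q. (mean l g q)\<^sup>2)"
      using csum_shift[OF p, of "2 ^ l"] by (simp add: csum_divide csum_add)
    finally show ?thesis .
  qed
  then show ?thesis unfolding box_form_def haar_form_def
    by (simp only: csum_add[symmetric] dmean_add[symmetric] periodic_col_product[OF G])
qed

lemma mean_square: "(mean l g q)\<^sup>2 = mean l (\<lambda>x. mean l (\<lambda>x'. g x * g x') q) q"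
  by (simp add: power2_eq_square dmean_mult)

text \<open>The product over the four corners of a rectangle does not distinguish rows from columns.\<close>
lemma box_form_transpose: "box_form G l k = box_form (\<lambda>x z. G z x) k l"
proof -
  have sw: "mean k (\<lambda>z. mean k (\<lambda>z'. (mean l (col_product G z z') q)\<^sup>2) p) p
    = mean l (\<lambda>x. mean l (\<lambda>x'. (mean k (col_product (\<lambda>x z. G z x) x x') p)\<^sup>2) q) q" for p q
  proof -
    define H where "H z z' x x' = G x z * G x z' * (G x' z * G x' z')" for z z' x x'
    have "mean k (\<lambda>z. mean k (\<lambda>z'. (mean l (col_product G z z') q)\<^sup>2) p) p
      = mean k (\<lambda>z. mean k (\<lambda>z'. mean l (\<lambda>x. mean l (\<lambda>x'. H z z' x x') q) q) p) p"
      by (simp add: mean_square col_product_def H_def)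
    also have "\<dots> = mean k (\<lambda>z. mean l (\<lambda>x. mean k (\<lambda>z'. mean l (\<lambda>x'. H z z' x x') q) p) q) p"
      by (subst dmean_swap) simp
    also have "\<dots> = mean k (\<lambda>z. mean l (\<lambda>x. mean l (\<lambda>x'. mean k (\<lambda>z'. H z z' x x') p) q) q) p"
      by (subst (3) dmean_swap) simp
    also have "\<dots> = mean l (\<lambda>x. mean k (\<lambda>z. mean l (\<lambda>x'. mean k (\<lambda>z'. H z z' x x') p) q) p) q"
      by (rule dmean_swap)
    also have "\<dots> = mean l (\<lambda>x. mean l (\<lambda>x'. mean k (\<lambda>z. mean k (\<lambda>z'. H z z' x x') p) p) q) q"
      by (subst (2) dmean_swap) simp
    also have "\<dots> = mean l (\<lambda>x. mean l (\<lambda>x'. (mean k (col_product (\<lambda>x z. G z x) x x') p)\<^sup>2) q) q"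
      by (simp add: mean_square col_product_def H_def mult_ac)
    finally show ?thesis .
  qed
  have "box_form G l k = csum (\<lambda>p. csum (\<lambda>q. mean k (\<lambda>z. mean k (\<lambda>z'. (mean l (col_product G z z') q)\<^sup>2) p) p))"
    by (simp add: box_form_def csum_dmean)
  also have "\<dots> = csum (\<lambda>q. csum (\<lambda>p. mean l (\<lambda>x. mean l (\<lambda>x'. (mean k (col_product (\<lambda>x z. G z x) x x') p)\<^sup>2) q) q))"
    by (subst csum_swap) (simp only: sw)
  also have "\<dots> = box_form (\<lambda>x z. G z x) k l"
    by (simp add: box_form_def csum_dmean)
  finally show ?thesis .
qed

lemma biperiodic_transpose: "biperiodic G \<Longrightarrow> biperiodic (\<lambda>x z. G z x)"
  by (auto simp: biperiodic_def periodic_def fun_eq_iff)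

text \<open>Monotonicity in the row scale is the positivity of \<open>haar_form\<close>; monotonicity in the column scale follows by transposing.\<close>
lemma box_form_antimono:
  assumes G: "biperiodic G" and "l \<le> l'" "k \<le> k'" shows "box_form G l' k' \<le> box_form G l k"
proof -
  have first: "box_form H i' k \<le> box_form H i k" if "biperiodic H" "i \<le> i'" for H i i' k
    using \<open>i \<le> i'\<close>
  proof (induction rule: dec_induct)
    case (step n)
    then show ?case using box_form_step[OF \<open>biperiodic H\<close>, of n k] haar_form_nonneg[of H n k k] by linarith
  qed simp
  have "box_form G l' k' \<le> box_form G l k'" by (rule first) fact+
  also have "\<dots> \<le> box_form G l k"
    unfolding box_form_transpose[of G] by (rule first[OF biperiodic_transpose[OF G]]) fact
  finally show ?thesis .
qed

lemma box_form_0_0: "box_form G 0 0 = norm4 G"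
proof -
  have "box_form G 0 0 = csum (\<lambda>p. csum (\<lambda>q. (G q p) ^ 4))"
    by (simp add: box_form_def col_product_def power2_eq_square power4_eq_xxxx mult_ac)
  then show ?thesis unfolding norm4_def by (subst csum_swap)
qed

lemma norm4_nonneg: "0 \<le> norm4 G"
  unfolding norm4_def by (intro csum_nonneg) auto

text \<open>For a fixed column scale the sum telescopes by \<open>box_form_step\<close>; each increase of the column scale only helps by
\<open>box_form_antimono\<close>. This works simultaneously for all scales because no constant is lost anywhere.\<close>
lemma sum_haar_form_le:
  assumes G: "biperiodic G" and e: "mono e" and \<kappa>: "mono \<kappa>"
  shows "(\<Sum>j<n. \<Sum>l\<in>{e j..<e (Suc j)}. haar_form G l (\<kappa> j) (\<kappa> j)) \<le> norm4 G"
proof -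
  have "(\<Sum>j<n. \<Sum>l\<in>{e j..<e (Suc j)}. haar_form G l (\<kappa> j) (\<kappa> j))
     \<le> (\<Sum>j<n. box_form G (e j) (\<kappa> j) - box_form G (e (Suc j)) (\<kappa> (Suc j)))"
  proof (rule sum_mono)
    fix j
    have ej: "e j \<le> e (Suc j)" using e by (simp add: monoD)
    have "(\<Sum>l\<in>{e j..<e (Suc j)}. haar_form G l (\<kappa> j) (\<kappa> j))
       = (\<Sum>l\<in>{e j..<e (Suc j)}. box_form G l (\<kappa> j) - box_form G (Suc l) (\<kappa> j))"
      by (rule sum.cong) (use box_form_step[OF G, of _ "\<kappa> j"] in \<open>auto simp: algebra_simps\<close>)
    also have "\<dots> = box_form G (e j) (\<kappa> j) - box_form G (e (Suc j)) (\<kappa> j)"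
      using sum_Suc_diff'[OF ej, of "\<lambda>l. - box_form G l (\<kappa> j)"] by simp
    also have "\<dots> \<le> box_form G (e j) (\<kappa> j) - box_form G (e (Suc j)) (\<kappa> (Suc j))"
      using box_form_antimono[OF G order_refl, of "\<kappa> j" "\<kappa> (Suc j)" "e (Suc j)"] \<kappa> by (simp add: monoD)
    finally show "(\<Sum>l\<in>{e j..<e (Suc j)}. haar_form G l (\<kappa> j) (\<kappa> j))
      \<le> box_form G (e j) (\<kappa> j) - box_form G (e (Suc j)) (\<kappa> (Suc j))" .
  qed
  also have "\<dots> = box_form G (e 0) (\<kappa> 0) - box_form G (e n) (\<kappa> n)"
    by (rule sum_lessThan_telescope')
  also have "\<dots> \<le> norm4 G"
    using box_form_nonneg[of G "e n" "\<kappa> n"] box_form_antimono[OF G, of 0 "e 0" 0 "\<kappa> 0"]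
    by (simp add: box_form_0_0)
  finally show ?thesis .
qed

text \<open>The summand depends only on the pair of columns, so the pair may be translated. Averaging over translations by
less than \<open>2 ^ b\<close> spreads both columns over windows of length \<open>2 ^ (b + 1)\<close>, at the cost of a factor two for each.\<close>
lemma haar_form_mixed:
  assumes G: "biperiodic G" and ab: "a \<le> b"
  shows "haar_form G l a b \<le> 4 * haar_form G l (Suc b) (Suc b)"
proof -
  define H where "H z z' = csum (\<lambda>q. (haar l (col_product G z z') q)\<^sup>2)" for z z'
  have H0: "0 \<le> H z z'" for z z' unfolding H_def by (intro csum_nonneg) auto
  have H1: "periodic H" and H2: "periodic (H z)" for z
    unfolding periodic_def H_def
    by (simp_all only: periodicD[OF biperiodic_col_product(1)[OF G]] periodicD[OF biperiodic_col_product(2)[OF G]] simp_thms)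
  define Z where "Z = csum (\<lambda>p. mean (Suc b) (\<lambda>z. mean (Suc b) (H z) p) p)"
  have key: "csum (\<lambda>p. mean b (H (p + i)) p) \<le> 4 * Z" if i: "0 \<le> i" "i < 2 ^ a" for i
  proof -
    have ib: "i \<le> 2 ^ b" using i(2) power_increasing[OF ab, of "2::int"] by linarith
    define X where "X p = mean b (H (p + i)) p" for p
    have perX: "periodic X"
    proof (rule periodicI)
      fix x
      have e1: "H (x + M + i) = H (x + i)" using periodicD[OF periodic_shift[OF H1]] by blast
      show "X (x + M) = X x" unfolding X_def e1
        using periodicD[OF periodic_dmean[OF H2]] by blast
    qed
    have "mean b X p \<le> 4 * mean (Suc b) (\<lambda>z. mean (Suc b) (H z) p) p" for p
    proof -
      define Y where "Y z = mean (Suc b) (H z) p" for z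
      have Y0: "0 \<le> Y z" for z unfolding Y_def by (intro dmean_nonneg H0)
      have "mean b X p \<le> mean b (\<lambda>t. 2 * Y (t + i)) p"
      proof (rule dmean_mono_local)
        fix t :: int assume t: "p \<le> t" "t < p + 2 ^ (0 + b)"
        have "2 ^ b * mean b (H (t + i)) t \<le> 2 ^ Suc b * mean (Suc b) (H (t + i)) p"
          by (rule mean_window_le) (use t H0 in auto)
        then show "X t \<le> 2 * Y (t + i)" unfolding X_def Y_def by (simp del: dmean.simps)
      qed
      also have "\<dots> = 2 * mean b Y (p + i)" by (simp add: dmean_cmult dmean_shift)
      also have "\<dots> \<le> 4 * mean (Suc b) Y p"
      proof -
        have "2 ^ b * mean b Y (p + i) \<le> 2 ^ Suc b * mean (Suc b) Y p"
          by (rule mean_window_le) (use i ib Y0 in auto)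
        then show ?thesis by (simp del: dmean.simps)
      qed
      finally show ?thesis unfolding Y_def .
    qed
    then have "csum (mean b X) \<le> csum (\<lambda>p. 4 * mean (Suc b) (\<lambda>z. mean (Suc b) (H z) p) p)"
      by (rule csum_mono)
    then show ?thesis
      unfolding csum_dmean_periodic[OF perX] csum_cmult Z_def X_def .
  qed
  have Hz: "H z = (\<lambda>z'. csum (\<lambda>q. (haar l (col_product G z z') q)\<^sup>2))" for z
    by (rule ext) (rule H_def)
  have "haar_form G l a b = csum (\<lambda>p. mean a (\<lambda>z. mean b (H z) p) p)"
    unfolding haar_form_def Hz ..
  also have "\<dots> = csum (\<lambda>p. mean a (\<lambda>i. mean b (H (p + i)) p) 0)"
  proof (rule csum_cong)
    fix p
    show "mean a (\<lambda>z. mean b (H z) p) p = mean a (\<lambda>i. mean b (H (p + i)) p) 0"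
      using dmean_shift[of 0 a "\<lambda>z. mean b (H z) p" p 0] by (simp only: add.commute[of p] add_0)
  qed
  also have "\<dots> = mean a (\<lambda>i. csum (\<lambda>p. mean b (H (p + i)) p)) 0" by (rule csum_dmean)
  also have "\<dots> \<le> mean a (\<lambda>i. 4 * Z) 0"
    by (rule dmean_mono_local) (use key in auto)
  finally show ?thesis unfolding Z_def haar_form_def Hz by simp
qed

end

section \<open>Changing the scale of the weight; the square function\<close>

lemma tent_dmean_param:
  "tent l (\<lambda>\<rho>. dmean s j (\<lambda>z. h z \<rho>) p) c = dmean s j (\<lambda>z. tent l (h z) c) p"
proof -
  have "mean l (\<lambda>\<rho>. dmean s j (\<lambda>z. h z \<rho>) p) = (\<lambda>q. dmean s j (\<lambda>z. mean l (h z) q) p)"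
    by (rule ext) (rule dmean_swap)
  then show ?thesis unfolding tent_def by (simp only:) (rule dmean_swap)
qed

context cyclic_sum
begin

text \<open>The tent weight splits into one window mean for each factor of the convolution, and a difference of
consecutive tents into one Haar coefficient for each factor. The reflection inside \<open>f\<close> accounts for the sign and for the shift
of the argument.\<close>
lemma tent_convolution:
  assumes g: "periodic g" and f: "periodic f"
  shows "tent l (\<lambda>\<rho>. csum (\<lambda>x. g x * f (r - \<rho> - x))) c
      = csum (\<lambda>x. mean l g x * mean l f (r - c - x - 2 ^ l + 1))" (is ?A)
    and "tent l (\<lambda>\<rho>. csum (\<lambda>x. g x * f (r - \<rho> - x))) c - tent (Suc l) (\<lambda>\<rho>. csum (\<lambda>x. g x * f (r - \<rho> - x))) c
      = - csum (\<lambda>x. haar l g x * haar l f (r - c - x - 2 * 2 ^ l + 1))" (is ?B)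
proof -
  define C where "C = (\<lambda>\<rho>. csum (\<lambda>x. g x * f (r - \<rho> - x)))"
  have step: "tent (Suc l) C c = csum (\<lambda>x. mean (Suc l) g x * mean (Suc l) f (r - c - x - 2 ^ Suc l + 1))
      \<and> tent l C c - tent (Suc l) C c = - csum (\<lambda>x. haar l g x * haar l f (r - c - x - 2 * 2 ^ l + 1))"
    if IH: "\<And>c. tent l C c = csum (\<lambda>x. mean l g x * mean l f (r - c - x - 2 ^ l + 1))" for l c
  proof -
    define n :: int where "n = 2 ^ l"
    define g' where "g' = mean l g"
    define f' where "f' = mean l f"
    define k where "k = r - c - n + 1"
    have pg: "periodic g'" and pf: "periodic f'" unfolding g'_def f'_def by (intro periodic_dmean g f)+
    have pp: "periodic (\<lambda>x. g' x * f' (d - x))" for d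
      using pg periodic_reflect[OF pf, of d] by (simp add: periodic_def)
    define A where "A = csum (\<lambda>x. g' x * f' (k - x))"
    define B where "B = csum (\<lambda>x. g' x * f' (k - n - x))"
    define E where "E = csum (\<lambda>x. g' x * f' (k + n - x))"
    have t1: "tent l C c = A" unfolding IH A_def g'_def f'_def k_def n_def
      by (simp add: algebra_simps)
    have t2: "tent l C (c + 2 ^ l) = B" unfolding IH B_def g'_def f'_def k_def n_def
      by (simp add: algebra_simps)
    have t3: "tent l C (c - 2 ^ l) = E" unfolding IH E_def g'_def f'_def k_def n_def
      by (simp add: algebra_simps)
    \<comment> \<open>in the shifted variable \<open>x + n\<close> the four products reduce to \<open>A\<close>, \<open>B\<close> and \<open>E\<close>\<close>
    have s1: "csum (\<lambda>x. g' (x + n) * f' (k - n - x)) = A"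
      using csum_shift[OF pp[of k], of n] unfolding A_def by (simp add: algebra_simps)
    have s2: "csum (\<lambda>x. g' (x + n) * f' (k - x)) = E"
      using csum_shift[OF pp[of "k + n"], of n] unfolding E_def by (simp add: algebra_simps)
    have ar: "r - c - x - 2 * 2 ^ l + 1 = k - n - x" for x
      by (simp add: k_def n_def)
    have kn: "k - n - x + n = k - x" for x by simp
    have h1: "mean (Suc l) g x * mean (Suc l) f (r - c - x - 2 ^ Suc l + 1)
       = (1/4) * (g' x * f' (k - x) + g' x * f' (k - n - x) + g' (x + n) * f' (k - n - x) + g' (x + n) * f' (k - x))" for x
    proof -
      have m1: "mean (Suc l) f (k - n - x) = (f' (k - n - x) + f' (k - x)) / 2"
        by (simp add: f'_def n_def)
      have m2: "mean (Suc l) g x = (g' x + g' (x + n)) / 2" by (simp add: g'_def n_def)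
      have m3: "r - c - x - 2 ^ Suc l + 1 = k - n - x" using ar[of x] by simp
      show ?thesis unfolding m3 m1 m2 by (simp add: field_simps)
    qed
    have h2: "haar l g x * haar l f (r - c - x - 2 * 2 ^ l + 1)
       = (1/4) * (g' x * f' (k - n - x) + g' (x + n) * f' (k - x) - g' x * f' (k - x) - g' (x + n) * f' (k - n - x))" for x
      unfolding ar unfolding haar_def unfolding g'_def[symmetric] f'_def[symmetric] n_def[symmetric] unfolding kn
      by (simp add: field_simps)
    have r1: "csum (\<lambda>x. mean (Suc l) g x * mean (Suc l) f (r - c - x - 2 ^ Suc l + 1)) = (1/4) * (A + B + A + E)"
      unfolding h1 csum_cmult csum_add s1 s2 by (simp add: A_def B_def)
    have r2: "csum (\<lambda>x. haar l g x * haar l f (r - c - x - 2 * 2 ^ l + 1)) = (1/4) * (B + E - A - A)"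
      unfolding h2 csum_cmult csum_diff csum_add s1 s2 by (simp add: A_def B_def)
    show ?thesis unfolding tent_Suc t1 t2 t3 r1 r2 by (simp add: field_simps)
  qed
  have all: "tent l C c = csum (\<lambda>x. mean l g x * mean l f (r - c - x - 2 ^ l + 1))" for l c
  proof (induction l arbitrary: c)
    case 0 show ?case by (simp add: C_def)
  next
    case (Suc l) then show ?case using step[of l c] by blast
  qed
  show ?A using all unfolding C_def .
  show ?B using step[OF all] unfolding C_def by blast
qed

lemma tent_convolution_diff_le:
  assumes g: "periodic g" and f: "periodic f"
  shows "\<bar>tent l (\<lambda>\<rho>. csum (\<lambda>x. g x * f (r - \<rho> - x))) c - tent (Suc l) (\<lambda>\<rho>. csum (\<lambda>x. g x * f (r - \<rho> - x))) c\<bar>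
     \<le> (csum (\<lambda>x. (haar l g x)\<^sup>2) + csum (\<lambda>x. (haar l f x)\<^sup>2)) / 2"
proof -
  define d where "d = r - c - 2 * 2 ^ l + 1"
  have "\<bar>csum (\<lambda>x. haar l g x * haar l f (d - x))\<bar> \<le> csum (\<lambda>x. \<bar>haar l g x * haar l f (d - x)\<bar>)"
    by (rule csum_abs)
  also have "\<dots> \<le> csum (\<lambda>x. ((haar l g x)\<^sup>2 + (haar l f (d - x))\<^sup>2) / 2)"
  proof (rule csum_mono)
    fix x
    have "\<bar>a * b\<bar> \<le> (a\<^sup>2 + b\<^sup>2) / 2" for a b :: real
      using zero_le_power2[of "\<bar>a\<bar> - \<bar>b\<bar>"] by (simp add: power2_diff abs_mult)
    then show "\<bar>haar l g x * haar l f (d - x)\<bar> \<le> ((haar l g x)\<^sup>2 + (haar l f (d - x))\<^sup>2) / 2" .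
  qed
  also have "\<dots> = (csum (\<lambda>x. (haar l g x)\<^sup>2) + csum (\<lambda>x. (haar l f (d - x))\<^sup>2)) / 2"
    by (simp only: csum_divide csum_add)
  also have "csum (\<lambda>x. (haar l f (d - x))\<^sup>2) = csum (\<lambda>x. (haar l f x)\<^sup>2)"
    by (rule csum_reflect) (use periodic_haar[OF f, of l] in \<open>simp add: periodic_def\<close>)
  finally show ?thesis unfolding tent_convolution(2)[OF g f] d_def by (simp add: algebra_simps)
qed

definition fibre :: "(int \<Rightarrow> int \<Rightarrow> real) \<Rightarrow> (int \<Rightarrow> int \<Rightarrow> real) \<Rightarrow> int \<Rightarrow> int \<Rightarrow> int \<Rightarrow> real" where
  "fibre F G x y z = F y z * G x z"

definition correlation :: "(int \<Rightarrow> int \<Rightarrow> real) \<Rightarrow> (int \<Rightarrow> int \<Rightarrow> real) \<Rightarrow> nat \<Rightarrow> nat \<Rightarrow> int \<Rightarrow> real" where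
  "correlation F G a b \<rho> = csum (\<lambda>x. csum (\<lambda>y. mean a (fibre F G x y) (x + y + \<rho>) * mean b (fibre F G x y) (x + y + \<rho>)))"

lemma periodic_fibre: "biperiodic F \<Longrightarrow> biperiodic G \<Longrightarrow> periodic (fibre F G x y)"
  by (auto simp: periodic_def biperiodic_def fibre_def)

lemma fibre_periodic: "biperiodic F \<Longrightarrow> fibre F G x (y + M) = fibre F G x y"
  by (auto simp: periodic_def biperiodic_def fibre_def fun_eq_iff)

text \<open>With \<open>p = x + y + \<rho>\<close> as new variable in place of \<open>y\<close>, the values of \<open>G\<close> depend on \<open>x\<close> only and those of \<open>F\<close> on
\<open>p - \<rho> - x\<close> only, for each fixed pair of columns.\<close>
lemma correlation_eq:
  assumes F: "biperiodic F" and G: "biperiodic G"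
  shows "correlation F G a b \<rho> = csum (\<lambda>p. mean a (\<lambda>z. mean b (\<lambda>z'. csum (\<lambda>x. col_product G z z' x * col_product F z z' (p - \<rho> - x))) p) p)"
proof -
  have inner: "csum (\<lambda>y. mean a (fibre F G x y) (x + y + \<rho>) * mean b (fibre F G x y) (x + y + \<rho>))
     = csum (\<lambda>p. mean a (\<lambda>z. mean b (\<lambda>z'. col_product G z z' x * col_product F z z' (p - \<rho> - x)) p) p)" for x
  proof -
    let ?h = "\<lambda>y. mean a (fibre F G x y) (x + y + \<rho>) * mean b (fibre F G x y) (x + y + \<rho>)"
    have "periodic ?h"
    proof (rule periodicI)
      fix y
      have "mean c (fibre F G x (y + M)) (x + (y + M) + \<rho>) = mean c (fibre F G x y) (x + y + \<rho>)" for c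
        using periodicD[OF periodic_dmean[OF periodic_fibre[OF F G, of x y]], of 0 c "x + y + \<rho>"] fibre_periodic[OF F, of G x y]
        by (simp add: algebra_simps)
      then show "?h (y + M) = ?h y" by simp
    qed
    then have "csum ?h = csum (\<lambda>p. ?h (p + (- \<rho> - x)))" by (rule csum_shift[symmetric])
    also have "\<dots> = csum (\<lambda>p. mean a (\<lambda>z. mean b (\<lambda>z'. col_product G z z' x * col_product F z z' (p - \<rho> - x)) p) p)"
    proof (rule csum_cong)
      fix p
      have e: "p + (- \<rho> - x) = p - \<rho> - x" "x + (p - \<rho> - x) + \<rho> = p" by auto
      show "?h (p + (- \<rho> - x)) = mean a (\<lambda>z. mean b (\<lambda>z'. col_product G z z' x * col_product F z z' (p - \<rho> - x)) p) p"
        unfolding e dmean_mult by (simp add: col_product_def fibre_def mult_ac)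
    qed
    finally show ?thesis .
  qed
  show ?thesis unfolding correlation_def inner
    by (subst csum_swap) (simp only: csum_dmean)
qed

text \<open>The cost of doubling the width of the weight: by \<open>tent_convolution\<close> both \<open>F\<close> and \<open>G\<close> contribute a Haar coefficient, and
the means in the column variables are kept. This is where cancellation in \<open>x\<close> and in \<open>y\<close> is used at the same time.\<close>
lemma correlation_tent_step:
  assumes F: "biperiodic F" and G: "biperiodic G"
  shows "\<bar>tent l (correlation F G a b) c - tent (Suc l) (correlation F G a b) c\<bar> \<le> (haar_form G l a b + haar_form F l a b) / 2"
proof -
  define C where "C p z z' \<rho> = csum (\<lambda>x. col_product G z z' x * col_product F z z' (p - \<rho> - x))" for p z z' \<rho>
  have T: "tent m (correlation F G a b) c = csum (\<lambda>p. mean a (\<lambda>z. mean b (\<lambda>z'. tent m (C p z z') c) p) p)" for m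
  proof -
    have "correlation F G a b = (\<lambda>\<rho>. csum (\<lambda>p. mean a (\<lambda>z. mean b (\<lambda>z'. C p z z' \<rho>) p) p))"
      unfolding C_def by (rule ext) (rule correlation_eq[OF F G])
    then have "tent m (correlation F G a b) c = csum (\<lambda>p. tent m (\<lambda>\<rho>. mean a (\<lambda>z. mean b (\<lambda>z'. C p z z' \<rho>) p) p) c)"
      by (simp only: csum_tent)
    then show ?thesis by (simp only: tent_dmean_param)
  qed
  have "\<bar>tent l (correlation F G a b) c - tent (Suc l) (correlation F G a b) c\<bar>
     = \<bar>csum (\<lambda>p. mean a (\<lambda>z. mean b (\<lambda>z'. tent l (C p z z') c - tent (Suc l) (C p z z') c) p) p)\<bar>"
    unfolding T by (simp only: csum_diff dmean_diff)
  also have "\<dots> \<le> csum (\<lambda>p. \<bar>mean a (\<lambda>z. mean b (\<lambda>z'. tent l (C p z z') c - tent (Suc l) (C p z z') c) p) p\<bar>)"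
    by (rule csum_abs)
  also have "\<dots> \<le> csum (\<lambda>p. mean a (\<lambda>z. mean b (\<lambda>z'. (1/2) * (csum (\<lambda>q. (haar l (col_product G z z') q)\<^sup>2) + csum (\<lambda>q. (haar l (col_product F z z') q)\<^sup>2))) p) p)"
  proof (rule csum_mono, rule order_trans[OF dmean_abs_le], rule dmean_mono, rule order_trans[OF dmean_abs_le], rule dmean_mono)
    fix p z z'
    show "\<bar>tent l (C p z z') c - tent (Suc l) (C p z z') c\<bar>
      \<le> (1/2) * (csum (\<lambda>q. (haar l (col_product G z z') q)\<^sup>2) + csum (\<lambda>q. (haar l (col_product F z z') q)\<^sup>2))"
      using tent_convolution_diff_le[OF periodic_col_product[OF G, of z z'] periodic_col_product[OF F, of z z'], of l p c]
      unfolding C_def by simp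
  qed
  also have "\<dots> = (haar_form G l a b + haar_form F l a b) / 2"
    unfolding haar_form_def by (simp only: csum_add dmean_add dmean_cmult csum_cmult)
  finally show ?thesis .
qed

lemma csum_fibre_square_le:
  assumes F: "biperiodic F" and G: "biperiodic G"
  shows "csum (\<lambda>x. csum (\<lambda>y. (fibre F G x y (x + y + \<rho>))\<^sup>2)) \<le> (norm4 F + norm4 G) / 2"
proof -
  have "csum (\<lambda>x. csum (\<lambda>y. (fibre F G x y (x + y + \<rho>))\<^sup>2))
     \<le> csum (\<lambda>x. csum (\<lambda>y. ((F y (x + y + \<rho>)) ^ 4 + (G x (x + y + \<rho>)) ^ 4) / 2))"
  proof (intro csum_mono)
    fix x y
    have "(a * b)\<^sup>2 \<le> (a ^ 4 + b ^ 4) / 2" for a b :: real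
      using zero_le_power2[of "a\<^sup>2 - b\<^sup>2"] by (simp add: power2_diff power_mult_distrib)
    then show "(fibre F G x y (x + y + \<rho>))\<^sup>2 \<le> ((F y (x + y + \<rho>)) ^ 4 + (G x (x + y + \<rho>)) ^ 4) / 2"
      unfolding fibre_def .
  qed
  also have "\<dots> = (csum (\<lambda>x. csum (\<lambda>y. (F y (x + y + \<rho>)) ^ 4)) + csum (\<lambda>x. csum (\<lambda>y. (G x (x + y + \<rho>)) ^ 4))) / 2"
    by (simp only: csum_add csum_divide)
  also have "csum (\<lambda>x. csum (\<lambda>y. (F y (x + y + \<rho>)) ^ 4)) = csum (\<lambda>y. csum (\<lambda>x. (F y (x + (y + \<rho>))) ^ 4))"
    by (subst csum_swap) (simp add: algebra_simps)
  also have "\<dots> = norm4 F" unfolding norm4_def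
  proof (rule csum_cong)
    fix y
    have "periodic (\<lambda>x. F y x ^ 4)" using F by (auto simp: periodic_def biperiodic_def)
    then show "csum (\<lambda>x. (F y (x + (y + \<rho>))) ^ 4) = csum (\<lambda>x. F y x ^ 4)" by (rule csum_shift)
  qed
  also have "csum (\<lambda>x. csum (\<lambda>y. (G x (x + y + \<rho>)) ^ 4)) = norm4 G" unfolding norm4_def
  proof (rule csum_cong)
    fix x
    have "periodic (\<lambda>z. G x z ^ 4)" using G by (auto simp: periodic_def biperiodic_def)
    from csum_shift[OF this, of "x + \<rho>"]
    show "csum (\<lambda>y. (G x (x + y + \<rho>)) ^ 4) = csum (\<lambda>x'. G x x' ^ 4)" by (simp add: algebra_simps)
  qed
  finally show ?thesis .
qed

lemma correlation_diag_nonneg: "0 \<le> correlation F G a a \<rho>"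
  unfolding correlation_def by (intro csum_nonneg) simp

text \<open>By Jensen and Young the estimate at a single scale is Hoelder's inequality.\<close>
lemma correlation_diag_le:
  assumes F: "biperiodic F" and G: "biperiodic G"
  shows "correlation F G a a \<rho> \<le> (norm4 F + norm4 G) / 2"
proof -
  have "correlation F G a a \<rho> \<le> csum (\<lambda>x. csum (\<lambda>y. mean a (\<lambda>i. (fibre F G x y (x + y + (\<rho> + i)))\<^sup>2) 0))"
    unfolding correlation_def
  proof (intro csum_mono)
    fix x y
    have "mean a (fibre F G x y) (x + y + \<rho>) * mean a (fibre F G x y) (x + y + \<rho>)
       \<le> mean a (\<lambda>i. (fibre F G x y i)\<^sup>2) (x + y + \<rho>)"
      using dmean_jensen[of 0 a "fibre F G x y" "x + y + \<rho>"] by (simp add: power2_eq_square)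
    also have "\<dots> = mean a (\<lambda>i. (fibre F G x y (x + y + (\<rho> + i)))\<^sup>2) 0"
      using dmean_shift[of 0 a "\<lambda>i. (fibre F G x y i)\<^sup>2" "x + y + \<rho>" 0] by (simp add: algebra_simps)
    finally show "mean a (fibre F G x y) (x + y + \<rho>) * mean a (fibre F G x y) (x + y + \<rho>) \<le> \<dots>" .
  qed
  also have "\<dots> = mean a (\<lambda>i. csum (\<lambda>x. csum (\<lambda>y. (fibre F G x y (x + y + (\<rho> + i)))\<^sup>2))) 0"
    by (simp only: csum_dmean)
  also have "\<dots> \<le> mean a (\<lambda>i. (norm4 F + norm4 G) / 2) 0"
    by (rule dmean_mono) (rule csum_fibre_square_le[OF F G])
  finally show ?thesis by simp
qed

definition haar_square :: "(int \<Rightarrow> int \<Rightarrow> real) \<Rightarrow> (int \<Rightarrow> int \<Rightarrow> real) \<Rightarrow> nat \<Rightarrow> int \<Rightarrow> real" where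
  "haar_square F G l \<rho> = csum (\<lambda>x. csum (\<lambda>y. (haar l (fibre F G x y) (x + y + \<rho>))\<^sup>2))"

lemma haar_square_nonneg: "0 \<le> haar_square F G l \<rho>"
  unfolding haar_square_def by (intro csum_nonneg) simp

lemma haar_square_eq:
  "haar_square F G l \<rho> = (correlation F G l l \<rho> + correlation F G l l (\<rho> + 2 ^ l)) / 2 - correlation F G (Suc l) (Suc l) \<rho>"
proof -
  have "(haar l h p)\<^sup>2 = (mean l h p * mean l h p + mean l h (p + 2 ^ l) * mean l h (p + 2 ^ l)) / 2
      - mean (Suc l) h p * mean (Suc l) h p" for h p
    using haar_parallelogram[of l h p] by (simp only: power2_eq_square)
  then show ?thesis unfolding haar_square_def correlation_def
    by (simp only: csum_diff csum_divide csum_add add.assoc)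
qed

text \<open>The parallelogram identity expresses the Haar square by correlations at the scales \<open>l\<close> and \<open>l + 1\<close>. The two
starting points \<open>- (2 ^ l)\<close> and \<open>0\<close> of the halves lie symmetrically about the neutral centre \<open>- (2 ^ (l - 1))\<close>, which leaves a second
difference; the other error is a doubling of the weight at scale \<open>l + m\<close>.\<close>
lemma tent_haar_square_step:
  assumes F: "biperiodic F" and G: "biperiodic G"
  defines "E \<equiv> \<lambda>m i. tent (Suc i + m) (correlation F G (Suc i) (Suc i)) (- (2 ^ i))"
  shows "tent (Suc i + m) (haar_square F G (Suc i)) (- (2 ^ Suc i))
     \<le> E m i - E m (Suc i)
       + (haar_form G i (Suc i) (Suc i) + haar_form F i (Suc i) (Suc i))
       + (haar_form G (Suc i + m) (Suc (Suc i)) (Suc (Suc i)) + haar_form F (Suc i + m) (Suc (Suc i)) (Suc (Suc i))) / 2"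
proof -
  let ?l = "Suc i" and ?t = "2 ^ i :: int"
  let ?c = "correlation F G ?l ?l" and ?c' = "correlation F G (Suc ?l) (Suc ?l)"
  have "haar_square F G ?l = (\<lambda>\<rho>. (1/2) * (?c \<rho> + ?c (\<rho> + 2 ^ ?l)) - ?c' \<rho>)"
    by (rule ext) (simp add: haar_square_eq)
  then have "tent (?l + m) (haar_square F G ?l) (- (2 ^ ?l))
     = (1/2) * (tent (?l + m) ?c (- (2 ^ ?l)) + tent (?l + m) ?c (- (2 ^ ?l) + 2 ^ ?l))
       - tent (?l + m) ?c' (- (2 ^ ?l))"
    by (simp only: tent_diff tent_cmult tent_add tent_shift)
  also have "\<dots> = (tent (?l + m) ?c (- ?t - ?t) + tent (?l + m) ?c (- ?t + ?t)) / 2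
       - tent (?l + m) ?c' (- (2 ^ ?l))"
    by simp
  finally have e: "tent (?l + m) (haar_square F G ?l) (- (2 ^ ?l))
      = (tent (?l + m) ?c (- ?t - ?t) + tent (?l + m) ?c (- ?t + ?t)) / 2
       - tent (?l + m) ?c' (- (2 ^ ?l))" .
  have a: "\<bar>tent (?l + m) ?c (- ?t) - (tent (?l + m) ?c (- ?t - ?t) + tent (?l + m) ?c (- ?t + ?t)) / 2\<bar>
     \<le> 2 * ((haar_form G i ?l ?l + haar_form F i ?l ?l) / 2)"
    by (rule tent_second_difference[OF correlation_tent_step[OF F G]]) simp
  have b: "\<bar>tent (?l + m) ?c' (- (2 ^ ?l)) - tent (Suc (?l + m)) ?c' (- (2 ^ ?l))\<bar>
     \<le> (haar_form G (?l + m) (Suc ?l) (Suc ?l) + haar_form F (?l + m) (Suc ?l) (Suc ?l)) / 2"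
    by (rule correlation_tent_step[OF F G])
  have E: "E m i = tent (?l + m) ?c (- ?t)" "E m (Suc i) = tent (Suc (?l + m)) ?c' (- (2 ^ ?l))"
    by (simp_all add: E_def)
  show ?thesis unfolding e E using a b unfolding abs_le_iff by argo
qed

text \<open>The bound is uniform in the excess \<open>m\<close> of the scale of the weight over the scale of the Haar functions. The
scale \<open>l = 0\<close> is estimated separately, since its neutral centre is not an integer.\<close>
lemma sum_tent_haar_square_le:
  assumes F: "biperiodic F" and G: "biperiodic G"
  shows "(\<Sum>l<n. tent (l + m) (haar_square F G l) (- (2 ^ l))) \<le> 3 * (norm4 F + norm4 G)"
proof -
  let ?N = "norm4 F + norm4 G"
  define E where "E i = tent (Suc i + m) (correlation F G (Suc i) (Suc i)) (- (2 ^ i))" for i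
  have E0: "0 \<le> E i" for i unfolding E_def by (intro tent_nonneg correlation_diag_nonneg)
  have E1: "E 0 \<le> ?N / 2"
    using tent_mono[of "correlation F G 1 1" "\<lambda>_. ?N / 2" "1 + m" "-1"] correlation_diag_le[OF F G, of 1]
    unfolding E_def by simp
  have zero: "tent (0 + m) (haar_square F G 0) (- (2 ^ 0)) \<le> ?N / 2"
  proof -
    have "haar_square F G 0 \<rho> \<le> ?N / 2" for \<rho>
      using haar_square_eq[of F G 0 \<rho>] correlation_diag_le[OF F G, of 0 \<rho>] correlation_diag_le[OF F G, of 0 "\<rho> + 2 ^ 0"]
        correlation_diag_nonneg[of F G "Suc 0" \<rho>] by argo
    then show ?thesis using tent_mono[of "haar_square F G 0" "\<lambda>_. ?N / 2" m "-1"] by simp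
  qed
  have T1: "(\<Sum>i<n. haar_form H i (Suc i) (Suc i)) \<le> norm4 H" if "biperiodic H" for H n
    using sum_haar_form_le[OF that, of "\<lambda>j. j" Suc n] by (simp add: mono_def)
  have T2: "(\<Sum>i<n. haar_form H (Suc i + m) (Suc (Suc i)) (Suc (Suc i))) \<le> norm4 H" if "biperiodic H" for H n
    using sum_haar_form_le[OF that, of "\<lambda>j. Suc j + m" "\<lambda>j. Suc (Suc j)" n] by (simp add: mono_def)
  have pos: "(\<Sum>i<n. tent (Suc i + m) (haar_square F G (Suc i)) (- (2 ^ Suc i))) \<le> 2 * ?N" for n
  proof -
    have "(\<Sum>i<n. tent (Suc i + m) (haar_square F G (Suc i)) (- (2 ^ Suc i)))
      \<le> (\<Sum>i<n. E i - E (Suc i)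
       + (haar_form G i (Suc i) (Suc i) + haar_form F i (Suc i) (Suc i))
       + (haar_form G (Suc i + m) (Suc (Suc i)) (Suc (Suc i)) + haar_form F (Suc i + m) (Suc (Suc i)) (Suc (Suc i))) / 2)"
      unfolding E_def by (rule sum_mono) (rule tent_haar_square_step[OF F G])
    also have "\<dots> = (E 0 - E n)
       + ((\<Sum>i<n. haar_form G i (Suc i) (Suc i)) + (\<Sum>i<n. haar_form F i (Suc i) (Suc i)))
       + ((\<Sum>i<n. haar_form G (Suc i + m) (Suc (Suc i)) (Suc (Suc i))) + (\<Sum>i<n. haar_form F (Suc i + m) (Suc (Suc i)) (Suc (Suc i)))) / 2"
      by (simp only: sum.distrib sum_divide_distrib[symmetric] sum_lessThan_telescope')
    also have "\<dots> \<le> 2 * ?N"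
      using T1[OF F, of n] T1[OF G, of n] T2[OF F, of n] T2[OF G, of n] E1 E0[of n] by argo
    finally show ?thesis .
  qed
  have N0: "0 \<le> ?N" by (simp add: norm4_nonneg)
  show ?thesis
  proof (cases n)
    case 0 then show ?thesis using N0 by simp
  next
    case (Suc k)
    have "(\<Sum>l<n. tent (l + m) (haar_square F G l) (- (2 ^ l)))
      = tent (0 + m) (haar_square F G 0) (- (2 ^ 0)) + (\<Sum>i<k. tent (Suc i + m) (haar_square F G (Suc i)) (- (2 ^ Suc i)))"
      unfolding Suc by (rule sum.lessThan_Suc_shift)
    then show ?thesis using zero pos[of k] N0 by argo
  qed
qed

end

section \<open>Families of kernels at a single scale\<close>

lemma dmean_commute: "dmean s j (dmean s' j' h) p = dmean s' j' (dmean s j h) p"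
proof -
  have e: "dmean s j h x = dmean s j (\<lambda>y. h (y + x)) 0" for s j x and h :: "int \<Rightarrow> real"
    using dmean_shift[of s j h x 0] by simp
  have "dmean s j (dmean s' j' h) p = dmean s j (\<lambda>x. dmean s' j' (\<lambda>y. h (y + x)) 0) p"
    by (rule arg_cong[where f = "\<lambda>g. dmean s j g p"], rule ext, rule e)
  also have "\<dots> = dmean s' j' (\<lambda>y. dmean s j (\<lambda>x. h (y + x)) p) 0" by (rule dmean_swap)
  also have "\<dots> = dmean s' j' (\<lambda>y. dmean s j h (y + p)) 0"
    using dmean_shift[of s j h _ p] by (simp add: add.commute)
  also have "\<dots> = dmean s' j' (dmean s j h) p"
    using dmean_shift[of s' j' "dmean s j h" p 0] by simp
  finally show ?thesis .
qed

text \<open>The constants satisfy \<open>(x + y)\<^sup>2 \<le> (4/3) x\<^sup>2 + 4 y\<^sup>2\<close>, so that the induction closes with equality; \<open>4/3 < 2\<close> leaves a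
geometric gain against coefficients of size \<open>2 ^ (l - L)\<close>.\<close>
lemma geometric_cauchy_schwarz:
  fixes b :: "nat \<Rightarrow> real"
  shows "(\<Sum>l<L. b l)\<^sup>2 \<le> 3 * (\<Sum>l<L. (4 / 3) ^ (L - l) * (b l)\<^sup>2)"
proof (induction L)
  case (Suc L)
  have sq: "(x + y)\<^sup>2 \<le> (4 / 3) * x\<^sup>2 + 4 * y\<^sup>2" for x y :: real
    using zero_le_power2[of "x - 3 * y"] by (simp add: power2_eq_square algebra_simps)
  have e: "(\<Sum>l<L. (4 / 3) ^ (Suc L - l) * (b l)\<^sup>2) = (4 / 3) * (\<Sum>l<L. (4 / 3) ^ (L - l) * (b l)\<^sup>2)"
    unfolding sum_distrib_left by (rule sum.cong) (auto simp: Suc_diff_le)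
  have "(\<Sum>l<Suc L. b l)\<^sup>2 \<le> (4 / 3) * (\<Sum>l<L. b l)\<^sup>2 + 4 * (b L)\<^sup>2"
    using sq[of "\<Sum>l<L. b l" "b L"] by simp
  also have "\<dots> \<le> (4 / 3) * (3 * (\<Sum>l<L. (4 / 3) ^ (L - l) * (b l)\<^sup>2)) + 4 * (b L)\<^sup>2"
    using Suc by simp
  also have "\<dots> = 3 * (\<Sum>l<Suc L. (4 / 3) ^ (Suc L - l) * (b l)\<^sup>2)"
    by (simp add: e)
  finally show ?case .
qed simp

lemma abs_increment_le:
  fixes \<phi> :: "int \<Rightarrow> real"
  shows "\<bar>\<phi> x - \<phi> (x + 2 ^ l)\<bar> \<le> 2 ^ l * mean l (\<lambda>z. \<bar>\<phi> (z + 1) - \<phi> z\<bar>) x"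
proof (induction l arbitrary: x)
  case (Suc l)
  have "\<bar>\<phi> x - \<phi> (x + 2 ^ Suc l)\<bar> \<le> \<bar>\<phi> x - \<phi> (x + 2 ^ l)\<bar> + \<bar>\<phi> (x + 2 ^ l) - \<phi> (x + 2 ^ l + 2 ^ l)\<bar>"
    by (simp add: algebra_simps)
  then show ?case using Suc[of x] Suc[of "x + 2 ^ l"] by (simp add: algebra_simps)
qed simp

text \<open>A Haar coefficient of a function of bounded variation sees only the variation inside its own support, hence the gain \<open>2 ^ l\<close>
at small scales.\<close>
lemma haar_le_variation:
  "\<bar>haar l \<phi> p\<bar> \<le> 2 ^ l * mean (Suc l) (\<lambda>z. \<bar>\<phi> (z + 1) - \<phi> z\<bar>) p"
proof -
  let ?D = "\<lambda>z. \<bar>\<phi> (z + 1) - \<phi> z\<bar>"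
  have "haar l \<phi> p = mean l (\<lambda>x. (1/2) * (\<phi> x - \<phi> (x + 2 ^ l))) p"
    by (simp only: haar_def dmean_cmult dmean_diff dmean_shift)
  then have "\<bar>haar l \<phi> p\<bar> \<le> mean l (\<lambda>x. \<bar>(1/2) * (\<phi> x - \<phi> (x + 2 ^ l))\<bar>) p"
    by (simp only: dmean_abs_le)
  also have "\<dots> \<le> mean l (\<lambda>x. 2 ^ l * mean (Suc l) ?D p) p"
  proof (rule dmean_mono_local)
    fix x :: int assume x: "p \<le> x" "x < p + 2 ^ (0 + l)"
    have "2 ^ l * mean l ?D x \<le> 2 ^ Suc l * mean (Suc l) ?D p"
      by (rule mean_window_le) (use x in auto)
    then have "\<bar>\<phi> x - \<phi> (x + 2 ^ l)\<bar> \<le> 2 ^ Suc l * mean (Suc l) ?D p"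
      using abs_increment_le[of \<phi> x l] by (rule order_trans[rotated])
    then show "\<bar>(1/2) * (\<phi> x - \<phi> (x + 2 ^ l))\<bar> \<le> 2 ^ l * mean (Suc l) ?D p"
      by (simp del: dmean.simps add: abs_mult)
  qed
  finally show ?thesis by simp
qed

lemma haar_le_mean: "\<bar>haar l \<phi> p\<bar> \<le> mean (Suc l) (\<lambda>z. \<bar>\<phi> z\<bar>) p"
  using dmean_abs_le[of 0 l \<phi> p] dmean_abs_le[of 0 l \<phi> "p + 2 ^ l"]
  by (simp add: haar_def abs_le_iff)

text \<open>Each pairing is expanded in Haar functions. At scale \<open>l\<close> one factor of the Haar coefficients of \<open>\<phi> j\<close> is summed
over positions, where bounded variation gives the gain \<open>2 ^ l\<close>, and the other is summed over the family, where the pointwise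
bound enters. For \<open>V\<close> of order \<open>2 ^ (- L)\<close> the result is a geometrically weighted sum over \<open>l\<close>.\<close>
lemma haar_family_bound:
  fixes \<phi> :: "'j \<Rightarrow> int \<Rightarrow> real" and f :: "int \<Rightarrow> real" and V :: real
  assumes J: "finite J" and V: "0 \<le> V"
    and zero: "\<And>j. j \<in> J \<Longrightarrow> mean L (\<phi> j) q = 0"
    and var: "\<And>j. j \<in> J \<Longrightarrow> 2 ^ L * mean L (\<lambda>z. \<bar>\<phi> j (z + 1) - \<phi> j z\<bar>) q \<le> V"
    and tot: "\<And>z. (\<Sum>j\<in>J. \<bar>\<phi> j z\<bar>) \<le> V"
  shows "(\<Sum>j\<in>J. (2 ^ L * mean L (\<lambda>z. \<phi> j z * f z) q)\<^sup>2)
     \<le> 3 * (V * 2 ^ L)\<^sup>2 * (\<Sum>l<L. (2 / 3) ^ (L - l) * dmean (Suc l) (L - Suc l) (\<lambda>p. (haar l f p)\<^sup>2) q)"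
proof -
  define b where "b j l = 2 ^ L * dmean (Suc l) (L - Suc l) (\<lambda>p. haar l (\<phi> j) p * haar l f p) q" for j l
  define D where "D l = dmean (Suc l) (L - Suc l) (\<lambda>p. (haar l f p)\<^sup>2) q" for l
  have exp: "2 ^ L * mean L (\<lambda>z. \<phi> j z * f z) q = (\<Sum>l<L. b j l)" if "j \<in> J" for j
    using zero[OF that] by (simp add: haar_expansion b_def sum_distrib_left)
  have b: "(\<Sum>j\<in>J. (b j l)\<^sup>2) \<le> 2 ^ l * 2 ^ L * V\<^sup>2 * D l" if l: "l < L" for l
  proof -
    let ?M = "dmean (Suc l) (L - Suc l)"
    have one: "(b j l)\<^sup>2 \<le> (2 ^ l * V) * (2 ^ L * ?M (\<lambda>p. \<bar>haar l (\<phi> j) p\<bar> * (haar l f p)\<^sup>2) q)"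
      if j: "j \<in> J" for j
    proof -
      have "(b j l)\<^sup>2 = 2 ^ L * 2 ^ L * (?M (\<lambda>p. haar l (\<phi> j) p * haar l f p) q)\<^sup>2"
        by (simp add: b_def power2_eq_square)
      also have "\<dots> \<le> 2 ^ L * 2 ^ L * (?M (\<lambda>p. \<bar>haar l (\<phi> j) p\<bar>) q * ?M (\<lambda>p. \<bar>haar l (\<phi> j) p\<bar> * (haar l f p)\<^sup>2) q)"
        by (intro mult_left_mono dmean_cauchy_schwarz) simp
      also have "\<dots> = (2 ^ L * ?M (\<lambda>p. \<bar>haar l (\<phi> j) p\<bar>) q) * (2 ^ L * ?M (\<lambda>p. \<bar>haar l (\<phi> j) p\<bar> * (haar l f p)\<^sup>2) q)"
        by simp
      also have "\<dots> \<le> (2 ^ l * V) * (2 ^ L * ?M (\<lambda>p. \<bar>haar l (\<phi> j) p\<bar> * (haar l f p)\<^sup>2) q)"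
      proof (rule mult_right_mono)
        let ?D = "\<lambda>z. \<bar>\<phi> j (z + 1) - \<phi> j z\<bar>"
        have "?M (\<lambda>p. \<bar>haar l (\<phi> j) p\<bar>) q \<le> ?M (\<lambda>p. 2 ^ l * mean (Suc l) ?D p) q"
          by (rule dmean_mono) (rule haar_le_variation)
        also have "\<dots> = 2 ^ l * ?M (mean (Suc l) ?D) q" by (rule dmean_cmult)
        also have "?M (mean (Suc l) ?D) q = mean L ?D q"
          using dmean_comp[of 0 "Suc l" "L - Suc l" ?D q] l by simp
        finally have "2 ^ L * ?M (\<lambda>p. \<bar>haar l (\<phi> j) p\<bar>) q \<le> 2 ^ l * (2 ^ L * mean L ?D q)"
          by (simp add: algebra_simps)
        also have "\<dots> \<le> 2 ^ l * V" using var[OF j] by simp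
        finally show "2 ^ L * ?M (\<lambda>p. \<bar>haar l (\<phi> j) p\<bar>) q \<le> 2 ^ l * V" .
      qed (auto intro!: mult_nonneg_nonneg dmean_nonneg)
      finally show ?thesis .
    qed
    have "(\<Sum>j\<in>J. (b j l)\<^sup>2) \<le> (\<Sum>j\<in>J. (2 ^ l * V) * (2 ^ L * ?M (\<lambda>p. \<bar>haar l (\<phi> j) p\<bar> * (haar l f p)\<^sup>2) q))"
      by (rule sum_mono) (rule one)
    also have "\<dots> = 2 ^ l * V * 2 ^ L * ?M (\<lambda>p. \<Sum>j\<in>J. \<bar>haar l (\<phi> j) p\<bar> * (haar l f p)\<^sup>2) q"
      by (simp only: dmean_sum sum_distrib_left mult.assoc)
    also have "\<dots> \<le> 2 ^ l * V * 2 ^ L * ?M (\<lambda>p. V * (haar l f p)\<^sup>2) q"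
    proof (intro mult_left_mono dmean_mono)
      fix p
      have "(\<Sum>j\<in>J. \<bar>haar l (\<phi> j) p\<bar>) \<le> (\<Sum>j\<in>J. mean (Suc l) (\<lambda>z. \<bar>\<phi> j z\<bar>) p)"
        by (rule sum_mono) (rule haar_le_mean)
      also have "\<dots> = mean (Suc l) (\<lambda>z. \<Sum>j\<in>J. \<bar>\<phi> j z\<bar>) p" by (rule dmean_sum[symmetric])
      also have "\<dots> \<le> mean (Suc l) (\<lambda>z. V) p" by (rule dmean_mono) (rule tot)
      finally have "(\<Sum>j\<in>J. \<bar>haar l (\<phi> j) p\<bar>) \<le> V" by simp
      then show "(\<Sum>j\<in>J. \<bar>haar l (\<phi> j) p\<bar> * (haar l f p)\<^sup>2) \<le> V * (haar l f p)\<^sup>2"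
        unfolding sum_distrib_right[symmetric] by (rule mult_right_mono) simp
    qed (use V in simp)
    also have "\<dots> = 2 ^ l * 2 ^ L * V\<^sup>2 * D l"
      by (simp add: dmean_cmult D_def power2_eq_square)
    finally show ?thesis .
  qed
  have "(\<Sum>j\<in>J. (2 ^ L * mean L (\<lambda>z. \<phi> j z * f z) q)\<^sup>2) = (\<Sum>j\<in>J. (\<Sum>l<L. b j l)\<^sup>2)"
    by (rule sum.cong) (simp_all add: exp)
  also have "\<dots> \<le> (\<Sum>j\<in>J. 3 * (\<Sum>l<L. (4 / 3) ^ (L - l) * (b j l)\<^sup>2))"
    by (rule sum_mono) (rule geometric_cauchy_schwarz)
  also have "\<dots> = 3 * (\<Sum>l<L. (4 / 3) ^ (L - l) * (\<Sum>j\<in>J. (b j l)\<^sup>2))"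
    by (simp only: sum_distrib_left sum.swap[of _ J])
  also have "\<dots> \<le> 3 * (\<Sum>l<L. (4 / 3) ^ (L - l) * (2 ^ l * 2 ^ L * V\<^sup>2 * D l))"
    by (intro mult_left_mono sum_mono b) auto
  also have "\<dots> = 3 * (\<Sum>l<L. (V * 2 ^ L)\<^sup>2 * ((2 / 3) ^ (L - l) * D l))"
  proof (rule arg_cong[where f = "\<lambda>x. 3 * x"], rule sum.cong, rule refl)
    fix l assume "l \<in> {..<L}"
    then have "(2::real) ^ L = 2 ^ (L - l) * 2 ^ l" by (simp add: power_add[symmetric])
    moreover have "(4 / 3 :: real) ^ (L - l) = (2 / 3) ^ (L - l) * 2 ^ (L - l)"
      by (simp add: power_mult_distrib[symmetric])
    ultimately show "(4 / 3) ^ (L - l) * (2 ^ l * 2 ^ L * V\<^sup>2 * D l) = (V * 2 ^ L)\<^sup>2 * ((2 / 3) ^ (L - l) * D l)"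
      by (simp add: power2_eq_square)
  qed
  finally show ?thesis by (simp add: sum_distrib_left D_def mult.assoc)
qed

text \<open>The left side does not see the position \<open>q\<close> of the window in which the Haar basis is built. Averaging over \<open>q\<close> replaces
the aligned positions of the Haar coefficients by all positions.\<close>
lemma haar_family_bound_averaged:
  fixes \<phi> :: "'j \<Rightarrow> int \<Rightarrow> real" and f :: "int \<Rightarrow> real" and V :: real
  assumes J: "finite J" and V: "0 \<le> V"
    and supp: "\<And>j z. j \<in> J \<Longrightarrow> \<phi> j z \<noteq> 0 \<Longrightarrow> q0 + 2 ^ L \<le> z \<and> z < q0 + 2 ^ Suc L"
    and zero: "\<And>j. j \<in> J \<Longrightarrow> (\<Sum>z\<in>{q0 + 2 ^ L..<q0 + 2 ^ Suc L}. \<phi> j z) = 0"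
    and var: "\<And>j A. j \<in> J \<Longrightarrow> finite A \<Longrightarrow> (\<Sum>z\<in>A. \<bar>\<phi> j (z + 1) - \<phi> j z\<bar>) \<le> V"
    and tot: "\<And>z. (\<Sum>j\<in>J. \<bar>\<phi> j z\<bar>) \<le> V"
  shows "(\<Sum>j\<in>J. (\<Sum>z\<in>{q0 + 2 ^ L..<q0 + 2 ^ Suc L}. \<phi> j z * f z)\<^sup>2)
     \<le> 12 * (V * 2 ^ Suc L)\<^sup>2 * (\<Sum>l<Suc L. (2 / 3) ^ (Suc L - l) * mean (L + 2) (\<lambda>p. (haar l f p)\<^sup>2) q0)"
    (is "?lhs \<le> _")
proof -
  let ?D = "\<lambda>l. dmean (Suc l) (Suc L - Suc l) (\<lambda>p. (haar l f p)\<^sup>2)"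
  have win: "2 ^ Suc L * mean (Suc L) (\<lambda>z. \<phi> j z * g z) q = (\<Sum>z\<in>{q0 + 2 ^ L..<q0 + 2 ^ Suc L}. \<phi> j z * g z)"
    if "j \<in> J" "q0 \<le> q" "q < q0 + 2 ^ L" for j g q
  proof -
    have "(\<Sum>z\<in>{q..<q + 2 ^ Suc L}. \<phi> j z * g z) = (\<Sum>z\<in>{q0 + 2 ^ L..<q0 + 2 ^ Suc L}. \<phi> j z * g z)"
      by (rule sum.mono_neutral_right) (use that supp[OF that(1)] in \<open>force+\<close>)
    then show ?thesis by (simp only: mean_eq_sum) simp
  qed
  have pt: "?lhs \<le> 3 * (V * 2 ^ Suc L)\<^sup>2 * (\<Sum>l<Suc L. (2 / 3) ^ (Suc L - l) * ?D l q)"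
    if q: "q0 \<le> q" "q < q0 + 2 ^ L" for q
  proof -
    have "(\<Sum>j\<in>J. (2 ^ Suc L * mean (Suc L) (\<lambda>z. \<phi> j z * f z) q)\<^sup>2)
     \<le> 3 * (V * 2 ^ Suc L)\<^sup>2 * (\<Sum>l<Suc L. (2 / 3) ^ (Suc L - l) * ?D l q)"
    proof (rule haar_family_bound[OF J V _ _ tot])
      fix j assume j: "j \<in> J"
      show "mean (Suc L) (\<phi> j) q = 0"
        using win[OF j q, of "\<lambda>_. 1"] zero[OF j] by (simp del: dmean.simps)
      show "2 ^ Suc L * mean (Suc L) (\<lambda>z. \<bar>\<phi> j (z + 1) - \<phi> j z\<bar>) q \<le> V"
        unfolding mean_eq_sum using var[OF j, of "{q..<q + 2 ^ Suc L}"] by simp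
    qed
    then show ?thesis using win[OF _ q] by (simp del: dmean.simps)
  qed
  have "?lhs = mean L (\<lambda>_. ?lhs) q0" by simp
  also have "\<dots> \<le> mean L (\<lambda>q. 3 * (V * 2 ^ Suc L)\<^sup>2 * (\<Sum>l<Suc L. (2 / 3) ^ (Suc L - l) * ?D l q)) q0"
    by (rule dmean_mono_local) (use pt in auto)
  also have "\<dots> = 3 * (V * 2 ^ Suc L)\<^sup>2 * (\<Sum>l<Suc L. (2 / 3) ^ (Suc L - l) * mean L (?D l) q0)"
    by (simp only: dmean_cmult dmean_sum)
  also have "\<dots> \<le> 3 * (V * 2 ^ Suc L)\<^sup>2 * (\<Sum>l<Suc L. (2 / 3) ^ (Suc L - l) * (4 * mean (L + 2) (\<lambda>p. (haar l f p)\<^sup>2) q0))"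
  proof (intro mult_left_mono sum_mono)
    fix l assume "l \<in> {..<Suc L}"
    then have l: "Suc l + (Suc L - Suc l) = Suc L" by auto
    let ?\<psi> = "\<lambda>p. (haar l f p)\<^sup>2"
    have "mean L (?D l) q0 = dmean (Suc l) (Suc L - Suc l) (mean L ?\<psi>) q0" by (rule dmean_commute)
    also have "\<dots> \<le> dmean (Suc l) (Suc L - Suc l) (\<lambda>_. 4 * mean (L + 2) ?\<psi> q0) q0"
    proof (rule dmean_mono_local, unfold l)
      fix x assume x: "q0 \<le> x" "x < q0 + 2 ^ Suc L"
      have "2 ^ L * mean L ?\<psi> x \<le> 2 ^ (L + 2) * mean (L + 2) ?\<psi> q0"
        by (rule mean_window_le) (use x in auto)
      then show "mean L ?\<psi> x \<le> 4 * mean (L + 2) ?\<psi> q0"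
        by (simp del: dmean.simps add: power_add)
    qed
    finally show "mean L (?D l) q0 \<le> 4 * mean (L + 2) ?\<psi> q0" by simp
  qed (use V in auto)
  also have "\<dots> = 12 * (V * 2 ^ Suc L)\<^sup>2 * (\<Sum>l<Suc L. (2 / 3) ^ (Suc L - l) * mean (L + 2) (\<lambda>p. (haar l f p)\<^sup>2) q0)"
    by (simp only: sum_distrib_left) (simp del: dmean.simps add: algebra_simps)
  finally show ?thesis .
qed

context cyclic_sum
begin

text \<open>The square functions at all scales up to \<open>2 ^ (k + 3)\<close>, discounted geometrically, with a weight of width comparable to
\<open>2 ^ k\<close>. It dominates every family of kernels that lives at scale \<open>2 ^ k\<close>.\<close>
definition scale_square :: "(int \<Rightarrow> int \<Rightarrow> real) \<Rightarrow> (int \<Rightarrow> int \<Rightarrow> real) \<Rightarrow> nat \<Rightarrow> real" where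
  "scale_square F G k = (\<Sum>l<k + 4. (2 / 3) ^ (k + 4 - l) * tent (k + 7) (haar_square F G l) (- (2 ^ l)))"

lemma scale_square_nonneg: "0 \<le> scale_square F G k"
  unfolding scale_square_def by (intro sum_nonneg mult_nonneg_nonneg tent_nonneg haar_square_nonneg) auto

text \<open>The double sum is rearranged by the difference \<open>i\<close> of the two scales: for each \<open>i\<close> the bound of
\<open>sum_tent_haar_square_le\<close> applies, and the discount factors sum to at most two.\<close>
lemma sum_scale_square_le:
  assumes F: "biperiodic F" and G: "biperiodic G"
  shows "(\<Sum>k<n. scale_square F G k) \<le> 6 * (norm4 F + norm4 G)"
proof -
  let ?N = "norm4 F + norm4 G"
  let ?T = "\<lambda>m l. tent (l + m) (haar_square F G l) (- (2 ^ l))"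
  have T0: "0 \<le> ?T m l" for m l by (intro tent_nonneg haar_square_nonneg)
  have scale_square: "scale_square F G k = (\<Sum>i<k + 4. (2 / 3) ^ Suc i * ?T (i + 4) (k + 3 - i))" for k
  proof -
    have "scale_square F G k = (\<Sum>i<k + 4. (2 / 3) ^ (k + 4 - (k + 4 - Suc i)) * tent (k + 7) (haar_square F G (k + 4 - Suc i)) (- (2 ^ (k + 4 - Suc i))))"
      unfolding scale_square_def by (rule sum.nat_diff_reindex[symmetric])
    also have "\<dots> = (\<Sum>i<k + 4. (2 / 3) ^ Suc i * ?T (i + 4) (k + 3 - i))"
    proof (rule sum.cong, rule refl)
      fix i assume "i \<in> {..<k + 4}"
      then have "k + 4 - (k + 4 - Suc i) = Suc i" "k + 4 - Suc i = k + 3 - i" "k + 3 - i + (i + 4) = k + 7"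
        by auto
      then show "(2 / 3) ^ (k + 4 - (k + 4 - Suc i)) * tent (k + 7) (haar_square F G (k + 4 - Suc i)) (- (2 ^ (k + 4 - Suc i)))
        = (2 / 3) ^ Suc i * ?T (i + 4) (k + 3 - i)" by (simp only:)
    qed
    finally show ?thesis .
  qed
  have "(\<Sum>k<n. scale_square F G k) = (\<Sum>k<n. \<Sum>i<n + 4. if i < k + 4 then (2 / 3) ^ Suc i * ?T (i + 4) (k + 3 - i) else 0)"
    unfolding scale_square
  proof (rule sum.cong, rule refl)
    fix k assume "k \<in> {..<n}"
    then have "{..<n + 4} \<inter> {i. i < k + 4} = {..<k + 4}" by auto
    then show "(\<Sum>i<k + 4. (2 / 3) ^ Suc i * ?T (i + 4) (k + 3 - i))
      = (\<Sum>i<n + 4. if i < k + 4 then (2 / 3) ^ Suc i * ?T (i + 4) (k + 3 - i) else 0)"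
      using sum.inter_restrict[of "{..<n + 4}" "\<lambda>i. (2 / 3) ^ Suc i * ?T (i + 4) (k + 3 - i)" "{i. i < k + 4}"] by simp
  qed
  also have "\<dots> = (\<Sum>i<n + 4. \<Sum>k<n. if i < k + 4 then (2 / 3) ^ Suc i * ?T (i + 4) (k + 3 - i) else 0)"
    by (rule sum.swap)
  also have "\<dots> \<le> (\<Sum>i<n + 4. (2 / 3) ^ Suc i * (3 * ?N))"
  proof (rule sum_mono)
    fix i
    have "(\<Sum>k<n. if i < k + 4 then (2 / 3) ^ Suc i * ?T (i + 4) (k + 3 - i) else 0)
      = (\<Sum>k\<in>{k. k < n \<and> i < k + 4}. (2 / 3) ^ Suc i * ?T (i + 4) (k + 3 - i))"
      by (subst sum.inter_filter[symmetric]) auto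
    also have "\<dots> = (\<Sum>l\<in>(\<lambda>k. k + 3 - i) ` {k. k < n \<and> i < k + 4}. (2 / 3) ^ Suc i * ?T (i + 4) l)"
      by (subst sum.reindex) (auto simp: inj_on_def)
    also have "\<dots> \<le> (\<Sum>l<n + 3. (2 / 3) ^ Suc i * ?T (i + 4) l)"
      by (rule sum_mono2) (auto intro!: mult_nonneg_nonneg T0)
    also have "\<dots> = (2 / 3) ^ Suc i * (\<Sum>l<n + 3. ?T (i + 4) l)" by (rule sum_distrib_left[symmetric])
    also have "\<dots> \<le> (2 / 3) ^ Suc i * (3 * ?N)"
      by (intro mult_left_mono sum_tent_haar_square_le[OF F G]) simp
    finally show "(\<Sum>k<n. if i < k + 4 then (2 / 3) ^ Suc i * ?T (i + 4) (k + 3 - i) else 0)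
      \<le> (2 / 3) ^ Suc i * (3 * ?N)" .
  qed
  also have "\<dots> = (\<Sum>i<n + 4. (2 / 3) ^ Suc i) * (3 * ?N)" by (rule sum_distrib_right[symmetric])
  also have "\<dots> \<le> 2 * (3 * ?N)"
  proof (rule mult_right_mono)
    have "(\<Sum>i<m. (2 / 3 :: real) ^ Suc i) = 2 - 2 * (2 / 3) ^ m" for m
      by (induction m) auto
    then show "(\<Sum>i<n + 4. (2 / 3 :: real) ^ Suc i) \<le> 2" by simp
    show "0 \<le> 3 * ?N" by (simp add: norm4_nonneg)
  qed
  finally show ?thesis by simp
qed

text \<open>Normalised kernels at scale \<open>2 ^ k\<close> with mean zero: bounded variation of each one and a pointwise bound for the
family are enough. The constant is \<open>12 * 16\<^sup>2 * 16\<close>.\<close>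
lemma single_scale_family_bound:
  fixes \<phi> :: "'j \<Rightarrow> int \<Rightarrow> real" and V :: real
  assumes F: "biperiodic F" and G: "biperiodic G" and J: "finite J" and V: "0 \<le> V"
    and supp: "\<And>j z. j \<in> J \<Longrightarrow> \<phi> j z \<noteq> 0 \<Longrightarrow> - (2 ^ (k + 2)) \<le> z \<and> z < 2 ^ (k + 2)"
    and zero: "\<And>j. j \<in> J \<Longrightarrow> (\<Sum>z\<in>{- (2 ^ (k + 2))..<2 ^ (k + 2)}. \<phi> j z) = 0"
    and var: "\<And>j A. j \<in> J \<Longrightarrow> finite A \<Longrightarrow> (\<Sum>z\<in>A. \<bar>\<phi> j (z + 1) - \<phi> j z\<bar>) \<le> V / 2 ^ k"
    and tot: "\<And>z. (\<Sum>j\<in>J. \<bar>\<phi> j z\<bar>) \<le> V / 2 ^ k"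
  shows "(\<Sum>j\<in>J. csum (\<lambda>x. csum (\<lambda>y. (\<Sum>z\<in>{- (2 ^ (k + 2))..<2 ^ (k + 2)}. \<phi> j z * fibre F G x y (x + y + z))\<^sup>2)))
     \<le> 49152 * V\<^sup>2 * scale_square F G k"
proof -
  \<comment> \<open>every window of length \<open>2 ^ (k + 4)\<close> that starts in \<open>{q0 ..< q0 + 2 ^ (k + 3)}\<close> contains the supports\<close>
  define q0 :: int where "q0 = - 3 * 2 ^ (k + 2)"
  define I :: "int set" where "I = {- (2 ^ (k + 2))..<2 ^ (k + 2)}"
  have q0: "q0 + 2 ^ (k + 3) = - (2 ^ (k + 2))" "q0 + 2 ^ Suc (k + 3) = 2 ^ (k + 2)"
    by (simp_all add: q0_def power_add)
  let ?R = "\<lambda>x y. 12 * (V / 2 ^ k * 2 ^ Suc (k + 3))\<^sup>2 * (\<Sum>l<Suc (k + 3). (2 / 3) ^ (Suc (k + 3) - l)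
       * mean (k + 3 + 2) (\<lambda>p. (haar l (fibre F G x y) (x + y + p))\<^sup>2) q0)"
  have pt: "(\<Sum>j\<in>J. (\<Sum>z\<in>I. \<phi> j z * fibre F G x y (x + y + z))\<^sup>2) \<le> ?R x y" for x y
  proof -
    have h: "haar l (\<lambda>z. fibre F G x y (x + y + z)) p = haar l (fibre F G x y) (x + y + p)" for l p
      using dmean_shift[of 0 l "fibre F G x y" "x + y"] by (simp add: haar_def add_ac)
    show ?thesis
      using haar_family_bound_averaged[OF J, of "V / 2 ^ k" \<phi> q0 "k + 3" "\<lambda>z. fibre F G x y (x + y + z)",
        unfolded q0, folded I_def, unfolded h] V supp zero var tot unfolding I_def by (simp del: dmean.simps)
  qed
  have "(\<Sum>j\<in>J. csum (\<lambda>x. csum (\<lambda>y. (\<Sum>z\<in>I. \<phi> j z * fibre F G x y (x + y + z))\<^sup>2)))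
     = csum (\<lambda>x. csum (\<lambda>y. \<Sum>j\<in>J. (\<Sum>z\<in>I. \<phi> j z * fibre F G x y (x + y + z))\<^sup>2))"
    by (simp only: csum_sum)
  also have "\<dots> \<le> csum (\<lambda>x. csum (\<lambda>y. ?R x y))" by (intro csum_mono pt)
  also have "\<dots> = 12 * (V / 2 ^ k * 2 ^ Suc (k + 3))\<^sup>2 * (\<Sum>l<Suc (k + 3). (2 / 3) ^ (Suc (k + 3) - l)
       * mean (k + 3 + 2) (haar_square F G l) q0)"
    unfolding haar_square_def[abs_def] by (simp only: csum_cmult csum_sum csum_dmean)
  also have "12 * (V / 2 ^ k * 2 ^ Suc (k + 3))\<^sup>2 = 3072 * V\<^sup>2"
    by (simp add: power_add power2_eq_square)
  also have "3072 * V\<^sup>2 * (\<Sum>l<Suc (k + 3). (2 / 3) ^ (Suc (k + 3) - l) * mean (k + 3 + 2) (haar_square F G l) q0)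
    \<le> 3072 * V\<^sup>2 * (\<Sum>l<Suc (k + 3). (2 / 3) ^ (Suc (k + 3) - l) * (16 * tent (k + 3 + 2 + 2) (haar_square F G l) (- (2 ^ l))))"
  proof (intro mult_left_mono sum_mono mean_le_tent haar_square_nonneg)
    fix l assume "l \<in> {..<Suc (k + 3)}"
    then have "(2::int) ^ l \<le> 2 ^ (k + 3)" by (intro power_increasing) auto
    then have l: "(2::int) ^ l \<le> 2 * 2 ^ (k + 2)" by (simp add: power_add)
    have l0: "(0::int) < 2 ^ l" by simp
    have e: "(2::int) ^ (k + 3 + 2 + 1) = 16 * 2 ^ (k + 2)" "(2::int) ^ (k + 3 + 2) = 8 * 2 ^ (k + 2)"
      by (simp_all add: power_add)
    show "- (2 ^ l) - 2 ^ (k + 3 + 2 + 1) \<le> q0" unfolding e q0_def using l0 zero_less_power[of "2::int" "k + 2"] by linarith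
    show "q0 + 2 ^ (k + 3 + 2) \<le> - (2 ^ l) + 1 + 2 ^ (k + 3 + 2)"
      unfolding e q0_def using l l0 zero_less_power[of "2::int" "k + 2"] by linarith
  qed auto
  also have "\<dots> = 49152 * V\<^sup>2 * scale_square F G k"
    unfolding scale_square_def sum_distrib_left by (rule sum.cong) (auto simp: add_ac eval_nat_numeral)
  finally show ?thesis unfolding I_def .
qed

end

section \<open>Jumps between dyadic lengths\<close>

definition avg_kernel :: "nat \<Rightarrow> int \<Rightarrow> int \<Rightarrow> real" where
  "avg_kernel n b z = (if b \<le> z \<and> z < b + int n then 1 / real n else 0)"

lemma sum_avg_kernel:
  assumes "- R \<le> b" "b + int n \<le> R"
  shows "(\<Sum>z\<in>{- R..<R}. avg_kernel n b z * h z) = (\<Sum>z\<in>{b..<b + int n}. h z) / real n"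
proof -
  have "(\<Sum>z\<in>{- R..<R}. avg_kernel n b z * h z) = (\<Sum>z\<in>{b..<b + int n}. avg_kernel n b z * h z)"
    by (rule sum.mono_neutral_right) (use assms in \<open>auto simp: avg_kernel_def\<close>)
  also have "\<dots> = (\<Sum>z\<in>{b..<b + int n}. h z / real n)"
    by (rule sum.cong) (auto simp: avg_kernel_def)
  finally show ?thesis by (simp add: sum_divide_distrib)
qed

lemma avg_kernel_variation:
  assumes "finite A"
  shows "(\<Sum>z\<in>A. \<bar>avg_kernel n b (z + 1) - avg_kernel n b z\<bar>) \<le> 2 / real n"
proof -
  have "(\<Sum>z\<in>A. \<bar>avg_kernel n b (z + 1) - avg_kernel n b z\<bar>)
     \<le> (\<Sum>z\<in>A. (if z = b - 1 then 1 / real n else 0) + (if z = b + int n - 1 then 1 / real n else 0))"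
    by (rule sum_mono) (auto simp: avg_kernel_def)
  also have "\<dots> \<le> 1 / real n + 1 / real n"
    unfolding sum.distrib using assms by (intro add_mono) (auto simp: sum.delta)
  finally show ?thesis by simp
qed

context cyclic_sum
begin

text \<open>The starting point \<open>b\<close> is relative to \<open>x + y\<close>; \<open>b = 0\<close> gives the averages of the theorem.\<close>
definition window_avg :: "(int \<Rightarrow> int \<Rightarrow> real) \<Rightarrow> (int \<Rightarrow> int \<Rightarrow> real) \<Rightarrow> nat \<Rightarrow> int \<Rightarrow> int \<Rightarrow> int \<Rightarrow> real" where
  "window_avg F G n b x y = (\<Sum>z\<in>{b..<b + int n}. fibre F G x y (x + y + z)) / real n"

lemma mean_fibre_eq_window_avg: "mean k (fibre F G x y) (x + y + b) = window_avg F G (2 ^ k) b x y"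
proof -
  have "(\<Sum>i\<in>{x + y + b..<x + y + b + 2 ^ k}. fibre F G x y i) = (\<Sum>z\<in>{b..<b + 2 ^ k}. fibre F G x y (x + y + z))"
    by (rule sum.reindex_bij_witness[of _ "\<lambda>z. x + y + z" "\<lambda>i. i - x - y"]) auto
  then show ?thesis by (simp add: mean_eq_sum window_avg_def)
qed

text \<open>Differences of averages whose lengths are at least \<open>2 ^ k\<close> and whose windows stay within distance \<open>2 ^ (k + 2)\<close>; each
kernel has variation at most \<open>4 / 2 ^ k\<close>.\<close>
lemma window_avg_family_bound:
  fixes n n' :: "'j \<Rightarrow> nat" and b b' :: "'j \<Rightarrow> int"
  assumes F: "biperiodic F" and G: "biperiodic G" and J: "finite J"
    and n: "\<And>j. j \<in> J \<Longrightarrow> 2 ^ k \<le> n j" "\<And>j. j \<in> J \<Longrightarrow> 2 ^ k \<le> n' j"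
    and b: "\<And>j. j \<in> J \<Longrightarrow> - (2 ^ (k + 2)) \<le> b j" "\<And>j. j \<in> J \<Longrightarrow> b j + int (n j) \<le> 2 ^ (k + 2)"
    and b': "\<And>j. j \<in> J \<Longrightarrow> - (2 ^ (k + 2)) \<le> b' j" "\<And>j. j \<in> J \<Longrightarrow> b' j + int (n' j) \<le> 2 ^ (k + 2)"
    and tot: "\<And>z. (\<Sum>j\<in>J. \<bar>avg_kernel (n j) (b j) z - avg_kernel (n' j) (b' j) z\<bar>) \<le> 4 / 2 ^ k"
  shows "(\<Sum>j\<in>J. csum (\<lambda>x. csum (\<lambda>y. (window_avg F G (n j) (b j) x y - window_avg F G (n' j) (b' j) x y)\<^sup>2))) \<le> 786432 * scale_square F G k"
proof -
  let ?\<phi> = "\<lambda>j z. avg_kernel (n j) (b j) z - avg_kernel (n' j) (b' j) z"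
  let ?I = "{- (2 ^ (k + 2))..<2 ^ (k + 2) :: int}"
  have pos: "0 < n j" "0 < n' j" if "j \<in> J" for j
    using n[OF that] zero_less_power[of "2::nat" k] by linarith+
  have e: "(\<Sum>z\<in>?I. ?\<phi> j z * h z) = (\<Sum>z\<in>{b j..<b j + int (n j)}. h z) / real (n j)
      - (\<Sum>z\<in>{b' j..<b' j + int (n' j)}. h z) / real (n' j)" if "j \<in> J" for j h
    using sum_avg_kernel[OF b(1)[OF that] b(2)[OF that], of h] sum_avg_kernel[OF b'(1)[OF that] b'(2)[OF that], of h]
    by (simp add: left_diff_distrib sum_subtractf)
  have "(\<Sum>j\<in>J. csum (\<lambda>x. csum (\<lambda>y. (\<Sum>z\<in>?I. ?\<phi> j z * fibre F G x y (x + y + z))\<^sup>2))) \<le> 49152 * 4\<^sup>2 * scale_square F G k"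
  proof (rule single_scale_family_bound[OF F G J])
    fix j z assume j: "j \<in> J" and "?\<phi> j z \<noteq> 0"
    then have "avg_kernel (n j) (b j) z \<noteq> 0 \<or> avg_kernel (n' j) (b' j) z \<noteq> 0" by auto
    then show "- (2 ^ (k + 2)) \<le> z \<and> z < 2 ^ (k + 2)"
      using b[OF j] b'[OF j] by (auto simp: avg_kernel_def split: if_splits)
  next
    fix j assume j: "j \<in> J"
    show "(\<Sum>z\<in>?I. ?\<phi> j z) = 0" using e[OF j, of "\<lambda>_. 1"] pos[OF j] by simp
  next
    fix j and A :: "int set" assume j: "j \<in> J" and A: "finite A"
    have k2: "2 / real m \<le> 2 / 2 ^ k" if "2 ^ k \<le> m" for m :: nat
    proof -
      have "(2::real) ^ k \<le> real m" using that by (metis of_nat_le_iff of_nat_numeral of_nat_power)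
      moreover from this have "0 < real m" by (rule less_le_trans[rotated]) simp
      ultimately show ?thesis by (intro divide_left_mono) auto
    qed
    have "(\<Sum>z\<in>A. \<bar>?\<phi> j (z + 1) - ?\<phi> j z\<bar>)
      \<le> (\<Sum>z\<in>A. \<bar>avg_kernel (n j) (b j) (z + 1) - avg_kernel (n j) (b j) z\<bar> + \<bar>avg_kernel (n' j) (b' j) (z + 1) - avg_kernel (n' j) (b' j) z\<bar>)"
      by (rule sum_mono) linarith
    also have "\<dots> \<le> 2 / real (n j) + 2 / real (n' j)"
      unfolding sum.distrib by (intro add_mono avg_kernel_variation A)
    also have "\<dots> \<le> 2 / 2 ^ k + 2 / 2 ^ k" by (intro add_mono k2 n j)
    finally show "(\<Sum>z\<in>A. \<bar>?\<phi> j (z + 1) - ?\<phi> j z\<bar>) \<le> 4 / 2 ^ k" by simp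
  qed (use tot in auto)
  moreover have "(\<Sum>j\<in>J. csum (\<lambda>x. csum (\<lambda>y. (\<Sum>z\<in>?I. ?\<phi> j z * fibre F G x y (x + y + z))\<^sup>2)))
     = (\<Sum>j\<in>J. csum (\<lambda>x. csum (\<lambda>y. (window_avg F G (n j) (b j) x y - window_avg F G (n' j) (b' j) x y)\<^sup>2)))"
    by (rule sum.cong) (simp_all only: e window_avg_def)
  ultimately show ?thesis by simp
qed

lemma avg_kernel_le: "2 ^ k \<le> n \<Longrightarrow> \<bar>avg_kernel n b z\<bar> \<le> 1 / 2 ^ k"
proof -
  assume "2 ^ k \<le> n"
  then have "(2::real) ^ k \<le> real n" by (metis of_nat_le_iff of_nat_numeral of_nat_power)
  moreover from this have "0 < real n" by (rule less_le_trans[rotated]) simp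
  ultimately have "1 / real n \<le> 1 / 2 ^ k"
    by (intro divide_left_mono) auto
  then show ?thesis by (simp add: avg_kernel_def)
qed

lemma window_avg_pair_bound:
  assumes F: "biperiodic F" and G: "biperiodic G"
    and n: "2 ^ k \<le> n" "2 ^ k \<le> n'"
    and b: "- (2 ^ (k + 2)) \<le> b" "b + int n \<le> 2 ^ (k + 2)" "- (2 ^ (k + 2)) \<le> b'" "b' + int n' \<le> 2 ^ (k + 2)"
  shows "csum (\<lambda>x. csum (\<lambda>y. (window_avg F G n b x y - window_avg F G n' b' x y)\<^sup>2)) \<le> 786432 * scale_square F G k"
proof -
  have "\<bar>avg_kernel n b z - avg_kernel n' b' z\<bar> \<le> 4 / 2 ^ k" for z
  proof -
    have "\<bar>avg_kernel n b z - avg_kernel n' b' z\<bar> \<le> 1 / 2 ^ k + 1 / 2 ^ k"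
      using avg_kernel_le[OF n(1), of b z] avg_kernel_le[OF n(2), of b' z] by linarith
    also have "\<dots> \<le> 4 / 2 ^ k" by (simp add: field_simps)
    finally show ?thesis .
  qed
  then show ?thesis
    using window_avg_family_bound[OF F G, of "{()}" k "\<lambda>_. n" "\<lambda>_. n'" "\<lambda>_. b" "\<lambda>_. b'"] n b by simp
qed

text \<open>The centre of the tent is the neutral one: it compensates for the distance from the start of a window to its middle.\<close>
definition energy :: "(int \<Rightarrow> int \<Rightarrow> real) \<Rightarrow> (int \<Rightarrow> int \<Rightarrow> real) \<Rightarrow> nat \<Rightarrow> real" where
  "energy F G k = tent k (correlation F G k k) (- (2 ^ (k - 1)))"

text \<open>The cost at scale \<open>l\<close> of changing the weight in a jump from \<open>2 ^ k\<close> to \<open>2 ^ K\<close>. The scale \<open>K + 1\<close> comes from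
\<open>haar_form_mixed\<close>, applied to the products of a short and a long mean.\<close>
definition jump_defect :: "(int \<Rightarrow> int \<Rightarrow> real) \<Rightarrow> (int \<Rightarrow> int \<Rightarrow> real) \<Rightarrow> nat \<Rightarrow> nat \<Rightarrow> nat \<Rightarrow> real" where
  "jump_defect F G k K l = (haar_form G l k k + haar_form F l k k) + (haar_form G l K K + haar_form F l K K)
     + (haar_form G l (Suc K) (Suc K) + haar_form F l (Suc K) (Suc K))"

text \<open>A mean of length \<open>2 ^ (k + j)\<close> is the mean of \<open>2 ^ j\<close> means of length \<open>2 ^ k\<close>, so the variance of the latter around the
former is a difference of energies. Moving the starting point of the long mean along with the short one costs a term at
scale \<open>2 ^ (k + j)\<close> only.\<close>
lemma dmean_jump_le:
  assumes F: "biperiodic F" and G: "biperiodic G" and \<rho>: "- (2 ^ (k + j + 1)) \<le> \<rho>" "\<rho> \<le> 2 ^ (k + j)"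
  shows "dmean k j (\<lambda>\<rho>. csum (\<lambda>x. csum (\<lambda>y. (window_avg F G (2 ^ k) \<rho> x y - window_avg F G (2 ^ (k + j)) \<rho> x y)\<^sup>2))) \<rho>
    \<le> 2 * (dmean k j (correlation F G k k) \<rho> - correlation F G (k + j) (k + j) \<rho>) + 2 * (786432 * scale_square F G (k + j))"
proof -
  let ?K = "k + j"
  define u where "u x y \<rho> = window_avg F G (2 ^ k) \<rho> x y" for x y \<rho>
  define v where "v x y \<rho> = window_avg F G (2 ^ ?K) \<rho> x y" for x y \<rho>
  have vu: "v x y \<rho> = dmean k j (u x y) \<rho>" for x y
  proof -
    have "v x y \<rho> = dmean k j (mean k (fibre F G x y)) (x + y + \<rho>)"
      unfolding v_def mean_fibre_eq_window_avg[symmetric] using dmean_comp[of 0 k j "fibre F G x y"] by simp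
    also have "\<dots> = dmean k j (\<lambda>i. mean k (fibre F G x y) (x + y + i)) \<rho>"
      using dmean_shift[of k j "mean k (fibre F G x y)" "x + y" \<rho>] by (simp add: add_ac)
    finally show ?thesis unfolding u_def mean_fibre_eq_window_avg .
  qed
  have pt: "dmean k j (\<lambda>i. (u x y i - v x y i)\<^sup>2) \<rho>
     \<le> 2 * (dmean k j (\<lambda>i. u x y i * u x y i) \<rho> - v x y \<rho> * v x y \<rho>)
       + 2 * dmean k j (\<lambda>i. (v x y \<rho> - v x y i)\<^sup>2) \<rho>" for x y
  proof -
    have "dmean k j (\<lambda>i. (u x y i - v x y i)\<^sup>2) \<rho>
      \<le> dmean k j (\<lambda>i. 2 * (u x y i * u x y i - (2 * v x y \<rho>) * u x y i + v x y \<rho> * v x y \<rho>)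
           + 2 * (v x y \<rho> - v x y i)\<^sup>2) \<rho>"
    proof (rule dmean_mono)
      fix i
      have "(a - c)\<^sup>2 \<le> 2 * (a * a - (2 * d) * a + d * d) + 2 * (d - c)\<^sup>2" for a c d :: real
        using zero_le_power2[of "a + c - 2 * d"] by (simp add: power2_eq_square algebra_simps)
      then show "(u x y i - v x y i)\<^sup>2 \<le> 2 * (u x y i * u x y i - (2 * v x y \<rho>) * u x y i + v x y \<rho> * v x y \<rho>)
           + 2 * (v x y \<rho> - v x y i)\<^sup>2" .
    qed
    also have "\<dots> = 2 * (dmean k j (\<lambda>i. u x y i * u x y i) \<rho> - (2 * v x y \<rho>) * dmean k j (u x y) \<rho> + v x y \<rho> * v x y \<rho>)
       + 2 * dmean k j (\<lambda>i. (v x y \<rho> - v x y i)\<^sup>2) \<rho>"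
      by (simp only: dmean_add dmean_diff dmean_cmult dmean_const)
    finally show ?thesis unfolding vu[symmetric] by (simp add: algebra_simps)
  qed
  have "dmean k j (\<lambda>i. csum (\<lambda>x. csum (\<lambda>y. (u x y i - v x y i)\<^sup>2))) \<rho>
     = csum (\<lambda>x. csum (\<lambda>y. dmean k j (\<lambda>i. (u x y i - v x y i)\<^sup>2) \<rho>))"
    by (simp only: csum_dmean)
  also have "\<dots> \<le> csum (\<lambda>x. csum (\<lambda>y. 2 * (dmean k j (\<lambda>i. u x y i * u x y i) \<rho> - v x y \<rho> * v x y \<rho>)
       + 2 * dmean k j (\<lambda>i. (v x y \<rho> - v x y i)\<^sup>2) \<rho>))"
    by (intro csum_mono pt)
  also have "\<dots> = 2 * (dmean k j (\<lambda>i. csum (\<lambda>x. csum (\<lambda>y. u x y i * u x y i))) \<rho> - csum (\<lambda>x. csum (\<lambda>y. v x y \<rho> * v x y \<rho>)))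
      + 2 * dmean k j (\<lambda>i. csum (\<lambda>x. csum (\<lambda>y. (v x y \<rho> - v x y i)\<^sup>2))) \<rho>"
    by (simp only: csum_add csum_diff csum_cmult csum_dmean)
  also have "(\<lambda>i. csum (\<lambda>x. csum (\<lambda>y. u x y i * u x y i))) = correlation F G k k"
    by (rule ext) (simp add: correlation_def mean_fibre_eq_window_avg u_def)
  also have "csum (\<lambda>x. csum (\<lambda>y. v x y \<rho> * v x y \<rho>)) = correlation F G ?K ?K \<rho>"
    by (simp add: correlation_def mean_fibre_eq_window_avg v_def)
  also have "dmean k j (\<lambda>i. csum (\<lambda>x. csum (\<lambda>y. (v x y \<rho> - v x y i)\<^sup>2))) \<rho> \<le> dmean k j (\<lambda>i. 786432 * scale_square F G ?K) \<rho>"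
  proof (rule dmean_mono_local)
    fix i assume i: "\<rho> \<le> i" "i < \<rho> + 2 ^ (k + j)"
    have e: "(2::int) ^ (k + j + 1) = 2 * 2 ^ (k + j)" "(2::int) ^ (k + j + 2) = 4 * 2 ^ (k + j)"
      by (simp_all add: power_add)
    have p: "(0::int) < 2 ^ (k + j)" by simp
    show "csum (\<lambda>x. csum (\<lambda>y. (v x y \<rho> - v x y i)\<^sup>2)) \<le> 786432 * scale_square F G ?K"
      unfolding v_def
      by (rule window_avg_pair_bound[OF F G]) (use \<rho> i p in \<open>unfold e, simp_all\<close>)
  qed
  finally show ?thesis by (simp add: u_def v_def)
qed

text \<open>The weight for the squared difference is first widened from scale \<open>k\<close> to scale \<open>k + j\<close>, where \<open>dmean_jump_le\<close> turns it into
energies; then it is narrowed back in the energy of the short means. Both changes are instances of \<open>tent_recentre\<close>. Replacing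
averages started at \<open>x + y\<close> by averages started nearby costs a single scale at each end.\<close>
lemma long_jump:
  assumes F: "biperiodic F" and G: "biperiodic G" and k: "1 \<le> k"
  shows "csum (\<lambda>x. csum (\<lambda>y. (window_avg F G (2 ^ (k + j)) 0 x y - window_avg F G (2 ^ k) 0 x y)\<^sup>2))
    \<le> 7077888 * (scale_square F G k + scale_square F G (k + j)) + 6 * (energy F G k - energy F G (k + j))
      + 36 * (\<Sum>l\<in>{k..<k + j}. jump_defect F G k (k + j) l + 2 * jump_defect F G k (k + j) (l - 1))"
proof -
  let ?K = "k + j" and ?c = "- (2 ^ (k - 1)) :: int" and ?C = "- (2 ^ (k + j - 1)) :: int"
  let ?err = "\<Sum>l\<in>{k..<?K}. jump_defect F G k ?K l + 2 * jump_defect F G k ?K (l - 1)"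
  have kk: "2 * 2 ^ (k - 1) = (2::int) ^ k" using k by (cases k) auto
  have KK: "2 * 2 ^ (k + j - 1) = (2::int) ^ (k + j)" using k by (cases k) auto
  define \<phi> where "\<phi> \<rho> = csum (\<lambda>x. csum (\<lambda>y. (window_avg F G (2 ^ k) \<rho> x y - window_avg F G (2 ^ ?K) \<rho> x y)\<^sup>2))" for \<rho>
  have \<phi>: "\<phi> = (\<lambda>\<rho>. correlation F G k k \<rho> - 2 * correlation F G k ?K \<rho> + correlation F G ?K ?K \<rho>)"
  proof
    fix \<rho>
    have "(a - b)\<^sup>2 = a * a - 2 * (a * b) + b * b" for a b :: real
      by (simp add: power2_eq_square algebra_simps)
    then show "\<phi> \<rho> = correlation F G k k \<rho> - 2 * correlation F G k ?K \<rho> + correlation F G ?K ?K \<rho>"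
      unfolding \<phi>_def correlation_def mean_fibre_eq_window_avg by (simp only: csum_add csum_diff csum_cmult)
  qed
  have B0: "\<bar>tent l (correlation F G k k) c - tent (Suc l) (correlation F G k k) c\<bar> \<le> 4 * jump_defect F G k ?K l" for l c
    using correlation_tent_step[OF F G, of l k k c] haar_form_nonneg[of G l k k] haar_form_nonneg[of F l k k]
      haar_form_nonneg[of G l ?K ?K] haar_form_nonneg[of F l ?K ?K]
      haar_form_nonneg[of G l "Suc ?K" "Suc ?K"] haar_form_nonneg[of F l "Suc ?K" "Suc ?K"]
    unfolding jump_defect_def by argo
  have B1: "\<bar>tent l \<phi> c - tent (Suc l) \<phi> c\<bar> \<le> 4 * jump_defect F G k ?K l" for l c
  proof -
    have T: "tent m \<phi> c = tent m (correlation F G k k) c - 2 * tent m (correlation F G k ?K) c + tent m (correlation F G ?K ?K) c" for m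
      unfolding \<phi> by (simp only: tent_add tent_diff tent_cmult)
    have "haar_form G l k ?K \<le> 4 * haar_form G l (Suc ?K) (Suc ?K)" "haar_form F l k ?K \<le> 4 * haar_form F l (Suc ?K) (Suc ?K)"
      by (intro haar_form_mixed F G, simp)+
    then show ?thesis
      using T[of l] T[of "Suc l"] correlation_tent_step[OF F G, of l k k c] correlation_tent_step[OF F G, of l k ?K c] correlation_tent_step[OF F G, of l ?K ?K c]
       haar_form_nonneg[of G l k k] haar_form_nonneg[of F l k k] haar_form_nonneg[of G l ?K ?K] haar_form_nonneg[of F l ?K ?K]
      unfolding jump_defect_def abs_le_iff by argo
  qed
  have sum4: "(\<Sum>l\<in>{k..<?K}. 4 * jump_defect F G k ?K l + 2 * (4 * jump_defect F G k ?K (l - 1))) = 4 * ?err"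
    by (simp add: sum_distrib_left algebra_simps)
  have Z0: "dmean k j (tent ?K (correlation F G k k)) ?C \<le> energy F G k + 4 * ?err"
    using tent_recentre[OF B0 k, of j] unfolding sum4 energy_def abs_le_iff by argo
  have Z1: "tent k \<phi> ?c \<le> dmean k j (tent ?K \<phi>) ?C + 4 * ?err"
    using tent_recentre[OF B1 k, of j] unfolding sum4 abs_le_iff by argo
  have "dmean k j (tent ?K \<phi>) ?C = tent ?K (dmean k j \<phi>) ?C" by (rule tent_dmean)
  also have "\<dots> \<le> tent ?K (\<lambda>\<rho>. 2 * (dmean k j (correlation F G k k) \<rho> - correlation F G ?K ?K \<rho>) + 2 * (786432 * scale_square F G ?K)) ?C"
  proof (rule tent_mono_local)
    fix \<rho> assume "?C - 2 ^ ?K < \<rho>" "\<rho> < ?C + 2 ^ ?K"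
    then have "- (2 ^ (k + j + 1)) \<le> \<rho>" "\<rho> \<le> 2 ^ (k + j)"
      using KK zero_less_power[of "2::int" "k + j - 1"] by (auto simp: power_add)
    from dmean_jump_le[OF F G this]
    show "dmean k j \<phi> \<rho> \<le> 2 * (dmean k j (correlation F G k k) \<rho> - correlation F G ?K ?K \<rho>) + 2 * (786432 * scale_square F G ?K)"
      unfolding \<phi>_def[abs_def] .
  qed
  also have "\<dots> = 2 * (tent ?K (dmean k j (correlation F G k k)) ?C - energy F G ?K) + 2 * (786432 * scale_square F G ?K)"
    by (simp only: tent_add tent_diff tent_cmult tent_const energy_def)
  also have "tent ?K (dmean k j (correlation F G k k)) ?C = dmean k j (tent ?K (correlation F G k k)) ?C"
    by (rule tent_dmean[symmetric])
  finally have T: "tent k \<phi> ?c \<le> 2 * (energy F G k - energy F G ?K) + 2 * (786432 * scale_square F G ?K) + 12 * ?err"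
    using Z0 Z1 by argo
  let ?L = "csum (\<lambda>x. csum (\<lambda>y. (window_avg F G (2 ^ ?K) 0 x y - window_avg F G (2 ^ k) 0 x y)\<^sup>2))"
  have "?L \<le> 3 * (786432 * scale_square F G k + 786432 * scale_square F G ?K) + 3 * \<phi> \<rho>"
    if \<rho>: "?c - 2 ^ k < \<rho>" "\<rho> < ?c + 2 ^ k" for \<rho>
  proof -
    have c0: "(0::int) < 2 ^ (k - 1)" by simp
    have "(2::int) ^ k \<le> 2 ^ ?K" by (intro power_increasing) auto
    note ar = \<rho> kk c0 this
    have e: "(2::int) ^ (m + 2) = 4 * 2 ^ m" for m by (simp add: power_add)
    have a: "csum (\<lambda>x. csum (\<lambda>y. (window_avg F G (2 ^ k) 0 x y - window_avg F G (2 ^ k) \<rho> x y)\<^sup>2)) \<le> 786432 * scale_square F G k"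
      by (rule window_avg_pair_bound[OF F G]; (rule order_refl)?; insert ar; unfold e of_nat_power of_nat_numeral; linarith)
    have b: "csum (\<lambda>x. csum (\<lambda>y. (window_avg F G (2 ^ ?K) 0 x y - window_avg F G (2 ^ ?K) \<rho> x y)\<^sup>2)) \<le> 786432 * scale_square F G ?K"
      by (rule window_avg_pair_bound[OF F G]; (rule order_refl)?; insert ar; unfold e of_nat_power of_nat_numeral; linarith)
    have "?L \<le> csum (\<lambda>x. csum (\<lambda>y. 3 * ((window_avg F G (2 ^ k) 0 x y - window_avg F G (2 ^ k) \<rho> x y)\<^sup>2
       + (window_avg F G (2 ^ ?K) 0 x y - window_avg F G (2 ^ ?K) \<rho> x y)\<^sup>2 + (window_avg F G (2 ^ k) \<rho> x y - window_avg F G (2 ^ ?K) \<rho> x y)\<^sup>2)))"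
    proof (intro csum_mono)
      fix x y
      have "(B - A)\<^sup>2 \<le> 3 * ((A - A')\<^sup>2 + (B - B')\<^sup>2 + (A' - B')\<^sup>2)" for A B A' B' :: real
      proof -
        have "(p + q + r)\<^sup>2 \<le> 3 * (p\<^sup>2 + q\<^sup>2 + r\<^sup>2)" for p q r :: real
          using zero_le_power2[of "p - q"] zero_le_power2[of "p - r"] zero_le_power2[of "q - r"]
          by (simp add: power2_eq_square algebra_simps)
        from this[of "A' - A" "B - B'" "B' - A'"] show ?thesis
          by (simp add: power2_commute)
      qed
      then show "(window_avg F G (2 ^ ?K) 0 x y - window_avg F G (2 ^ k) 0 x y)\<^sup>2 \<le> 3 * ((window_avg F G (2 ^ k) 0 x y - window_avg F G (2 ^ k) \<rho> x y)\<^sup>2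
       + (window_avg F G (2 ^ ?K) 0 x y - window_avg F G (2 ^ ?K) \<rho> x y)\<^sup>2 + (window_avg F G (2 ^ k) \<rho> x y - window_avg F G (2 ^ ?K) \<rho> x y)\<^sup>2)" .
    qed
    also have "\<dots> = 3 * (csum (\<lambda>x. csum (\<lambda>y. (window_avg F G (2 ^ k) 0 x y - window_avg F G (2 ^ k) \<rho> x y)\<^sup>2))
       + csum (\<lambda>x. csum (\<lambda>y. (window_avg F G (2 ^ ?K) 0 x y - window_avg F G (2 ^ ?K) \<rho> x y)\<^sup>2)) + \<phi> \<rho>)"
      unfolding \<phi>_def by (simp only: csum_cmult csum_add)
    finally show ?thesis using a b by argo
  qed
  then have "tent k (\<lambda>_. ?L) ?c \<le> tent k (\<lambda>\<rho>. 3 * (786432 * scale_square F G k + 786432 * scale_square F G ?K) + 3 * \<phi> \<rho>) ?c"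
    by (rule tent_mono_local)
  also have "\<dots> = 3 * (786432 * scale_square F G k + 786432 * scale_square F G ?K) + 3 * tent k \<phi> ?c"
    by (simp only: tent_add tent_cmult tent_const)
  finally have "?L \<le> 3 * (786432 * scale_square F G k + 786432 * scale_square F G ?K) + 3 * tent k \<phi> ?c" by simp
  then show ?thesis using T scale_square_nonneg[of F G k] by argo
qed

end

section \<open>Variation along an arbitrary increasing sequence\<close>

context cyclic_sum
begin

lemma sum_jump_defect_le:
  assumes F: "biperiodic F" and G: "biperiodic G" and \<kappa>: "mono \<kappa>" "\<And>i. 1 \<le> \<kappa> i"
  shows "(\<Sum>i<n. \<Sum>l\<in>{\<kappa> i..<\<kappa> (Suc i)}. jump_defect F G (\<kappa> i) (\<kappa> (Suc i)) l + 2 * jump_defect F G (\<kappa> i) (\<kappa> (Suc i)) (l - 1))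
    \<le> 9 * (norm4 F + norm4 G)"
proof -
  have a: "(\<Sum>i<n. \<Sum>l\<in>{e i..<e (Suc i)}. jump_defect F G (\<kappa> i) (\<kappa> (Suc i)) l) \<le> 3 * (norm4 F + norm4 G)"
    if e: "mono e" for e
  proof -
    have m: "mono (\<lambda>i. \<kappa> (Suc i))" "mono (\<lambda>i. Suc (\<kappa> (Suc i)))"
      using \<kappa>(1) by (auto simp: mono_def)
    show ?thesis unfolding jump_defect_def sum.distrib
      using sum_haar_form_le[OF F e \<kappa>(1), of n] sum_haar_form_le[OF G e \<kappa>(1), of n]
        sum_haar_form_le[OF F e m(1), of n] sum_haar_form_le[OF G e m(1), of n]
        sum_haar_form_le[OF F e m(2), of n] sum_haar_form_le[OF G e m(2), of n] by argo
  qed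
  have sh: "(\<Sum>l\<in>{\<kappa> i..<\<kappa> (Suc i)}. h (l - 1)) = (\<Sum>l\<in>{\<kappa> i - 1..<\<kappa> (Suc i) - 1}. h l)" for i and h :: "nat \<Rightarrow> real"
    by (rule sum.reindex_bij_witness[of _ Suc "\<lambda>l. l - 1"]) (use \<kappa>(2)[of i] \<kappa>(2)[of "Suc i"] in auto)
  have "mono (\<lambda>i. \<kappa> i - 1)" using \<kappa>(1) by (auto simp: mono_def diff_le_mono)
  from a[OF this] a[OF \<kappa>(1)]
  show ?thesis unfolding sum.distrib sum_distrib_left[symmetric] sh by argo
qed

lemma sum_scale_square_jumps_le:
  assumes F: "biperiodic F" and G: "biperiodic G" and inj: "inj_on g I" and I: "finite I"
  shows "(\<Sum>i\<in>I. scale_square F G (g i)) \<le> 6 * (norm4 F + norm4 G)"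
proof -
  obtain m where m: "g ` I \<subseteq> {..<m}"
    using I by (meson finite_imageI finite_nat_set_iff_bounded lessThan_iff subsetI)
  have "(\<Sum>i\<in>I. scale_square F G (g i)) = (\<Sum>k\<in>g ` I. scale_square F G k)"
    using inj by (simp add: sum.reindex)
  also have "\<dots> \<le> (\<Sum>k<m. scale_square F G k)"
    by (rule sum_mono2) (use m scale_square_nonneg in auto)
  also have "\<dots> \<le> 6 * (norm4 F + norm4 G)" by (rule sum_scale_square_le[OF F G])
  finally show ?thesis .
qed

lemma inj_on_jumps:
  fixes \<kappa> :: "nat \<Rightarrow> nat"
  assumes "mono \<kappa>"
  shows "inj_on \<kappa> {i. i < n \<and> \<kappa> i < \<kappa> (Suc i)}" "inj_on (\<lambda>i. \<kappa> (Suc i)) {i. i < n \<and> \<kappa> i < \<kappa> (Suc i)}"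
proof -
  have lt: "\<kappa> i < \<kappa> j" "\<kappa> (Suc i) < \<kappa> (Suc j)" if "i < j" "\<kappa> i < \<kappa> (Suc i)" "\<kappa> j < \<kappa> (Suc j)" for i j
    using that monoD[OF assms, of "Suc i" j] by auto
  show "inj_on \<kappa> {i. i < n \<and> \<kappa> i < \<kappa> (Suc i)}"
    by (rule inj_onI) (metis (mono_tags, lifting) lt(1) mem_Collect_eq nat_neq_iff)
  show "inj_on (\<lambda>i. \<kappa> (Suc i)) {i. i < n \<and> \<kappa> i < \<kappa> (Suc i)}"
    by (rule inj_onI) (metis (mono_tags, lifting) lt(2) mem_Collect_eq nat_neq_iff)
qed

lemma energy_le: "biperiodic F \<Longrightarrow> biperiodic G \<Longrightarrow> energy F G k \<le> (norm4 F + norm4 G) / 2"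
  using tent_mono[of "correlation F G k k" "\<lambda>_. (norm4 F + norm4 G) / 2" k "- (2 ^ (k - 1))"] correlation_diag_le
  unfolding energy_def by simp

lemma energy_nonneg: "0 \<le> energy F G k"
  unfolding energy_def by (intro tent_nonneg correlation_diag_nonneg)

abbreviation sq_distance :: "(int \<Rightarrow> int \<Rightarrow> real) \<Rightarrow> (int \<Rightarrow> int \<Rightarrow> real) \<Rightarrow> nat \<Rightarrow> nat \<Rightarrow> real" where
  "sq_distance F G n m \<equiv> csum (\<lambda>x. csum (\<lambda>y. (window_avg F G n 0 x y - window_avg F G m 0 x y)\<^sup>2))"

text \<open>Only genuine jumps pay the single-scale terms, and their end points lie at distinct scales; the energies telescope, and
the changes of weight are summed by \<open>sum_haar_form_le\<close> with column scales that increase along the sequence.\<close>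
lemma dyadic_variation:
  assumes F: "biperiodic F" and G: "biperiodic G" and \<kappa>: "mono \<kappa>" "\<And>i. 1 \<le> \<kappa> i"
  shows "(\<Sum>i<n. sq_distance F G (2 ^ \<kappa> (Suc i)) (2 ^ \<kappa> i)) \<le> 84934983 * (norm4 F + norm4 G)"
proof -
  let ?J = "{i. i < n \<and> \<kappa> i < \<kappa> (Suc i)}"
  let ?N = "norm4 F + norm4 G"
  define err where "err i = (\<Sum>l\<in>{\<kappa> i..<\<kappa> (Suc i)}. jump_defect F G (\<kappa> i) (\<kappa> (Suc i)) l + 2 * jump_defect F G (\<kappa> i) (\<kappa> (Suc i)) (l - 1))" for i
  have "(\<Sum>i<n. sq_distance F G (2 ^ \<kappa> (Suc i)) (2 ^ \<kappa> i))
     \<le> (\<Sum>i<n. (if i \<in> ?J then 7077888 * (scale_square F G (\<kappa> i) + scale_square F G (\<kappa> (Suc i))) else 0)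
          + 6 * (energy F G (\<kappa> i) - energy F G (\<kappa> (Suc i))) + 36 * err i)"
  proof (rule sum_mono)
    fix i assume "i \<in> {..<n}"
    show "sq_distance F G (2 ^ \<kappa> (Suc i)) (2 ^ \<kappa> i)
     \<le> (if i \<in> ?J then 7077888 * (scale_square F G (\<kappa> i) + scale_square F G (\<kappa> (Suc i))) else 0)
          + 6 * (energy F G (\<kappa> i) - energy F G (\<kappa> (Suc i))) + 36 * err i"
    proof (cases "\<kappa> i < \<kappa> (Suc i)")
      case True
      then show ?thesis
        using long_jump[OF F G \<kappa>(2)[of i], of "\<kappa> (Suc i) - \<kappa> i"] \<open>i \<in> {..<n}\<close>
        by (simp add: err_def)
    next
      case False
      then have "\<kappa> (Suc i) = \<kappa> i" using \<kappa>(1) by (simp add: mono_def order.antisym)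
      then show ?thesis by (simp add: err_def csum_def)
    qed
  qed
  also have "\<dots> = (\<Sum>i<n. (if i \<in> ?J then 7077888 * (scale_square F G (\<kappa> i) + scale_square F G (\<kappa> (Suc i))) else 0))
       + 6 * (energy F G (\<kappa> 0) - energy F G (\<kappa> n)) + 36 * (\<Sum>i<n. err i)"
    using sum_lessThan_telescope'[of "\<lambda>i. energy F G (\<kappa> i)" n]
    by (simp only: sum.distrib sum_distrib_left[symmetric])
  also have "(\<Sum>i<n. (if i \<in> ?J then 7077888 * (scale_square F G (\<kappa> i) + scale_square F G (\<kappa> (Suc i))) else 0))
     = 7077888 * ((\<Sum>i\<in>?J. scale_square F G (\<kappa> i)) + (\<Sum>i\<in>?J. scale_square F G (\<kappa> (Suc i))))"
  proof -
    have "{..<n} \<inter> ?J = ?J" by auto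
    then have "(\<Sum>i<n. (if i \<in> ?J then 7077888 * (scale_square F G (\<kappa> i) + scale_square F G (\<kappa> (Suc i))) else 0))
      = (\<Sum>i\<in>?J. 7077888 * (scale_square F G (\<kappa> i) + scale_square F G (\<kappa> (Suc i))))"
      by (simp only: sum.inter_restrict[symmetric] finite_lessThan)
    then show ?thesis by (simp only: sum_distrib_left[symmetric] sum.distrib)
  qed
  also have "7077888 * ((\<Sum>i\<in>?J. scale_square F G (\<kappa> i)) + (\<Sum>i\<in>?J. scale_square F G (\<kappa> (Suc i))))
       + 6 * (energy F G (\<kappa> 0) - energy F G (\<kappa> n)) + 36 * (\<Sum>i<n. err i)
     \<le> 7077888 * (6 * ?N + 6 * ?N) + 6 * (?N / 2 - 0) + 36 * (9 * ?N)"
    unfolding err_def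
    by (intro add_mono mult_left_mono diff_mono sum_scale_square_jumps_le[OF F G] sum_jump_defect_le[OF F G \<kappa>] inj_on_jumps \<kappa>(1)
        energy_le[OF F G] energy_nonneg) auto
  finally show ?thesis by argo
qed

lemma sum_group_by_scale:
  fixes \<kappa> :: "nat \<Rightarrow> nat"
  assumes F: "biperiodic F" and G: "biperiodic G"
    and le: "\<And>K. (\<Sum>i\<in>{i. i < n \<and> \<kappa> i = K}. h i) \<le> c * scale_square F G K" and c: "0 \<le> c"
  shows "(\<Sum>i<n. h i) \<le> c * (6 * (norm4 F + norm4 G))"
proof -
  have "(\<Sum>i<n. h i) = (\<Sum>K\<in>\<kappa> ` {..<n}. \<Sum>i\<in>{i \<in> {..<n}. \<kappa> i = K}. h i)"
    by (rule sum.image_gen) simp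
  also have "\<dots> \<le> (\<Sum>K\<in>\<kappa> ` {..<n}. c * scale_square F G K)"
    by (rule sum_mono) (use le in simp)
  also have "\<dots> = c * (\<Sum>K\<in>\<kappa> ` {..<n}. scale_square F G (id K))" by (simp add: sum_distrib_left)
  also have "\<dots> \<le> c * (6 * (norm4 F + norm4 G))"
    by (intro mult_left_mono sum_scale_square_jumps_le[OF F G] c) auto
  finally show ?thesis .
qed

text \<open>With \<open>2 ^ \<kappa> i\<close> the largest power of two below \<open>t i\<close>, each increment is split at the powers of two. Inside a block
the lengths increase, which bounds the pointwise sum of the kernels; between blocks the increment is a dyadic jump and one
leftover piece in the block that is left.\<close>
lemma variation_from_two:
  fixes t :: "nat \<Rightarrow> nat"
  assumes F: "biperiodic F" and G: "biperiodic G" and t: "mono t" "\<And>i. 2 \<le> t i"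
  shows "(\<Sum>i<n. sq_distance F G (t (Suc i)) (t i)) \<le> 283116501 * (norm4 F + norm4 G)"
proof -
  let ?N = "norm4 F + norm4 G"
  define \<kappa> where "\<kappa> i = floor_log (t i)" for i
  have \<kappa>: "mono \<kappa>" using t(1) floor_log_mono by (auto simp: mono_def \<kappa>_def)
  have \<kappa>1: "1 \<le> \<kappa> i" for i unfolding \<kappa>_def using t(2)[of i] floor_log_rec[of "t i"] by simp
  have lo: "2 ^ \<kappa> i \<le> t i" for i
    unfolding \<kappa>_def by (rule floor_log_exp2_le) (use t(2)[of i] in simp)
  have hi: "t i < 2 * 2 ^ \<kappa> i" for i
    unfolding \<kappa>_def using floor_log_exp2_gt[of "t i"] t(2)[of i] by simp
  \<comment> \<open>the previous length, cut off at the beginning of the block of the current one\<close>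
  define c where "c K i = max (t i) (2 ^ K)" for K i
  have zero: "sq_distance F G m m = 0" for m by (simp add: csum_def)
  have nonneg: "0 \<le> sq_distance F G m m'" for m m' by (intro csum_nonneg) simp
  have e4: "(2::int) ^ (m + 2) = 4 * 2 ^ m" for m by (simp add: power_add)
  have short: "(\<Sum>i\<in>{i. i < n \<and> \<kappa> (Suc i) = K}. sq_distance F G (t (Suc i)) (c K i)) \<le> 786432 * scale_square F G K" for K
  proof (rule window_avg_family_bound[OF F G])
    fix i assume i: "i \<in> {i. i < n \<and> \<kappa> (Suc i) = K}"
    have ti: "t i \<le> t (Suc i)" using t(1) by (simp add: mono_def)
    show "2 ^ K \<le> t (Suc i)" using lo[of "Suc i"] i by simp
    show "2 ^ K \<le> c K i" by (simp add: c_def)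
    have h: "t (Suc i) < 2 * 2 ^ K" using hi[of "Suc i"] i by simp
    then have "int (t (Suc i)) < 2 * 2 ^ K"
      by (metis of_nat_less_iff of_nat_mult of_nat_numeral of_nat_power)
    then show "0 + int (t (Suc i)) \<le> 2 ^ (K + 2)" by (simp add: e4)
    have "c K i < 2 * 2 ^ K" using h ti by (simp add: c_def)
    then have "int (c K i) < 2 * 2 ^ K"
      by (metis of_nat_less_iff of_nat_mult of_nat_numeral of_nat_power)
    then show "0 + int (c K i) \<le> 2 ^ (K + 2)" by (simp add: e4)
  next
    fix z :: int
    \<comment> \<open>increasing in \<open>m\<close>, with increments dominating those of the kernel, which jumps up by \<open>1 / m\<close> once \<open>m\<close> exceeds \<open>z\<close> and decreases afterwards\<close>
    define H where "H m = (if 0 \<le> z \<and> z < int m then 2 / 2 ^ K - 1 / real m else 0)" for m :: nat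
    have inv: "1 / real m \<le> 1 / 2 ^ K" if "2 ^ K \<le> m" for m :: nat
      using avg_kernel_le[OF that, of 0 0] that by (simp add: avg_kernel_def split: if_splits)
    have bH: "\<bar>avg_kernel m 0 z - avg_kernel m' 0 z\<bar> \<le> H m - H m'" if "2 ^ K \<le> m'" "m' \<le> m" for m m'
    proof -
      have "0 < m'" using that(1) by (metis less_le_trans zero_less_numeral zero_less_power)
      then have "1 / real m \<le> 1 / real m'" using that by (intro divide_left_mono) auto
      then show ?thesis using inv[OF that(1)] inv[of m] that by (auto simp: avg_kernel_def H_def)
    qed
    have cm: "c K i \<le> c K (Suc i)" for i
      using monoD[OF t(1), of i "Suc i"] by (auto simp: c_def max_def)
    have cl: "2 ^ K \<le> c K i" for i by (simp add: c_def)
    have "(\<Sum>i\<in>{i. i < n \<and> \<kappa> (Suc i) = K}. \<bar>avg_kernel (t (Suc i)) 0 z - avg_kernel (c K i) 0 z\<bar>)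
      \<le> (\<Sum>i\<in>{i. i < n \<and> \<kappa> (Suc i) = K}. H (c K (Suc i)) - H (c K i))"
    proof (rule sum_mono)
      fix i assume i: "i \<in> {i. i < n \<and> \<kappa> (Suc i) = K}"
      then have "c K (Suc i) = t (Suc i)" using lo[of "Suc i"] by (simp add: c_def)
      then show "\<bar>avg_kernel (t (Suc i)) 0 z - avg_kernel (c K i) 0 z\<bar> \<le> H (c K (Suc i)) - H (c K i)"
        using bH[OF cl cm, of i] by simp
    qed
    also have "\<dots> \<le> (\<Sum>i<n. H (c K (Suc i)) - H (c K i))"
      by (rule sum_mono2) (use order_trans[OF abs_ge_zero bH[OF cl cm]] in auto)
    also have "\<dots> = H (c K n) - H (c K 0)" by (rule sum_lessThan_telescope)
    also have "\<dots> \<le> 2 / 2 ^ K"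
    proof -
      have "H (c K n) \<le> 2 / 2 ^ K" by (simp add: H_def)
      moreover have "(1::real) / 2 ^ K \<le> 2 / 2 ^ K" by (rule divide_right_mono) simp_all
      then have "0 \<le> H (c K 0)"
        using order_trans[OF inv[OF cl, of 0]] by (simp add: H_def)
      ultimately show ?thesis by linarith
    qed
    also have "\<dots> \<le> 4 / 2 ^ K" by (simp add: field_simps)
    finally show "(\<Sum>i\<in>{i. i < n \<and> \<kappa> (Suc i) = K}. \<bar>avg_kernel (t (Suc i)) 0 z - avg_kernel (c K i) 0 z\<bar>) \<le> 4 / 2 ^ K" .
  qed auto
  define g where "g i = (if \<kappa> i < \<kappa> (Suc i) then sq_distance F G (2 ^ \<kappa> i) (t i) else 0)" for i
  have single: "(\<Sum>i<n. g i) \<le> 786432 * (6 * ?N)"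
  proof -
    let ?J = "{i. i < n \<and> \<kappa> i < \<kappa> (Suc i)}"
    have "(\<Sum>i<n. g i) = (\<Sum>i\<in>?J. sq_distance F G (2 ^ \<kappa> i) (t i))"
    proof -
      have "{..<n} \<inter> {i. \<kappa> i < \<kappa> (Suc i)} = ?J" by auto
      then show ?thesis unfolding g_def
        using sum.inter_restrict[of "{..<n}" "\<lambda>i. sq_distance F G (2 ^ \<kappa> i) (t i)" "{i. \<kappa> i < \<kappa> (Suc i)}"] by simp
    qed
    also have "\<dots> \<le> (\<Sum>i\<in>?J. 786432 * scale_square F G (\<kappa> i))"
    proof (rule sum_mono)
      fix i
      have "int (t i) < 2 * 2 ^ \<kappa> i"
        using hi[of i] by (metis of_nat_less_iff of_nat_mult of_nat_numeral of_nat_power)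
      then show "sq_distance F G (2 ^ \<kappa> i) (t i) \<le> 786432 * scale_square F G (\<kappa> i)"
        by (intro window_avg_pair_bound[OF F G] lo) (auto simp: e4)
    qed
    also have "\<dots> = 786432 * (\<Sum>i\<in>?J. scale_square F G (\<kappa> i))" by (rule sum_distrib_left[symmetric])
    also have "\<dots> \<le> 786432 * (6 * ?N)"
      by (intro mult_left_mono sum_scale_square_jumps_le[OF F G] inj_on_jumps \<kappa>) auto
    finally show ?thesis .
  qed
  have split: "sq_distance F G (t (Suc i)) (t i)
     \<le> 3 * (sq_distance F G (t (Suc i)) (c (\<kappa> (Suc i)) i) + sq_distance F G (2 ^ \<kappa> (Suc i)) (2 ^ \<kappa> i) + g i)" for i
  proof (cases "\<kappa> i < \<kappa> (Suc i)")
    case False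
    then have "\<kappa> (Suc i) = \<kappa> i" using \<kappa> by (simp add: mono_def order.antisym)
    then have "c (\<kappa> (Suc i)) i = t i" "sq_distance F G (2 ^ \<kappa> (Suc i)) (2 ^ \<kappa> i) = 0"
      using lo[of i] zero[of "2 ^ \<kappa> i"] by (simp_all add: c_def)
    moreover have "g i = 0" using False by (simp add: g_def)
    ultimately show ?thesis using nonneg[of "t (Suc i)" "t i"] by simp
  next
    case True
    have "(2::nat) ^ Suc (\<kappa> i) \<le> 2 ^ \<kappa> (Suc i)" by (rule power_increasing) (use True in auto)
    then have "c (\<kappa> (Suc i)) i = 2 ^ \<kappa> (Suc i)" using hi[of i] by (simp add: c_def)
    moreover have "(p - s)\<^sup>2 \<le> 3 * ((p - q)\<^sup>2 + (q - r)\<^sup>2 + (r - s)\<^sup>2)" for p q r s :: real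
    proof -
      have "(a + b + d)\<^sup>2 \<le> 3 * (a\<^sup>2 + b\<^sup>2 + d\<^sup>2)" for a b d :: real
        using zero_le_power2[of "a - b"] zero_le_power2[of "a - d"] zero_le_power2[of "b - d"]
        by (simp add: power2_eq_square algebra_simps)
      from this[of "p - q" "q - r" "r - s"] show ?thesis by simp
    qed
    then have "sq_distance F G (t (Suc i)) (t i)
      \<le> csum (\<lambda>x. csum (\<lambda>y. 3 * ((window_avg F G (t (Suc i)) 0 x y - window_avg F G (2 ^ \<kappa> (Suc i)) 0 x y)\<^sup>2
         + (window_avg F G (2 ^ \<kappa> (Suc i)) 0 x y - window_avg F G (2 ^ \<kappa> i) 0 x y)\<^sup>2 + (window_avg F G (2 ^ \<kappa> i) 0 x y - window_avg F G (t i) 0 x y)\<^sup>2)))"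
      by (intro csum_mono)
    ultimately show ?thesis using True by (simp only: csum_cmult csum_add g_def if_True)
  qed
  have "(\<Sum>i<n. sq_distance F G (t (Suc i)) (t i))
    \<le> (\<Sum>i<n. 3 * (sq_distance F G (t (Suc i)) (c (\<kappa> (Suc i)) i) + sq_distance F G (2 ^ \<kappa> (Suc i)) (2 ^ \<kappa> i) + g i))"
    by (rule sum_mono) (rule split)
  also have "\<dots> = 3 * ((\<Sum>i<n. sq_distance F G (t (Suc i)) (c (\<kappa> (Suc i)) i)) + (\<Sum>i<n. sq_distance F G (2 ^ \<kappa> (Suc i)) (2 ^ \<kappa> i)) + (\<Sum>i<n. g i))"
    by (simp only: sum_distrib_left[symmetric] sum.distrib)
  also have "\<dots> \<le> 3 * (786432 * (6 * ?N) + 84934983 * ?N + 786432 * (6 * ?N))"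
  proof (intro mult_left_mono add_mono single dyadic_variation[OF F G \<kappa> \<kappa>1])
    show "(\<Sum>i<n. sq_distance F G (t (Suc i)) (c (\<kappa> (Suc i)) i)) \<le> 786432 * (6 * ?N)"
    proof (rule sum_group_by_scale[OF F G, where \<kappa> = "\<lambda>i. \<kappa> (Suc i)"])
      fix K
      show "(\<Sum>i | i < n \<and> \<kappa> (Suc i) = K. sq_distance F G (t (Suc i)) (c (\<kappa> (Suc i)) i)) \<le> 786432 * scale_square F G K"
        using short[of K] by simp
    qed simp
  qed simp
  also have "\<dots> = 283116501 * ?N" by simp
  finally show ?thesis .
qed

lemma window_avg_square_le:
  assumes F: "biperiodic F" and G: "biperiodic G"
  shows "csum (\<lambda>x. csum (\<lambda>y. (window_avg F G n b x y)\<^sup>2)) \<le> (norm4 F + norm4 G) / 2"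
proof (cases "n = 0")
  case True then show ?thesis by (simp add: window_avg_def csum_def norm4_nonneg)
next
  case False
  let ?I = "{b..<b + int n}"
  have pt: "(window_avg F G n b x y)\<^sup>2 \<le> (1 / real n) * (\<Sum>z\<in>?I. (fibre F G x y (x + y + z))\<^sup>2)" for x y
  proof -
    have "(\<Sum>z\<in>?I. fibre F G x y (x + y + z))\<^sup>2 \<le> (\<Sum>z\<in>?I. (fibre F G x y (x + y + z))\<^sup>2) * real n"
      using sum_squared_le_sum_of_squares[of "\<lambda>z. fibre F G x y (x + y + z)" ?I] by simp
    then show ?thesis using False by (simp add: window_avg_def power_divide power2_eq_square field_simps)
  qed
  have "csum (\<lambda>x. csum (\<lambda>y. (window_avg F G n b x y)\<^sup>2))
     \<le> csum (\<lambda>x. csum (\<lambda>y. (1 / real n) * (\<Sum>z\<in>?I. (fibre F G x y (x + y + z))\<^sup>2)))"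
    by (intro csum_mono pt)
  also have "\<dots> = (1 / real n) * (\<Sum>z\<in>?I. csum (\<lambda>x. csum (\<lambda>y. (fibre F G x y (x + y + z))\<^sup>2)))"
    by (simp only: csum_cmult csum_sum)
  also have "\<dots> \<le> (1 / real n) * (\<Sum>z\<in>?I. (norm4 F + norm4 G) / 2)"
    by (intro mult_left_mono sum_mono csum_fibre_square_le[OF F G]) simp
  also have "\<dots> = (norm4 F + norm4 G) / 2" using False by simp
  finally show ?thesis .
qed

text \<open>Only the first length can be one, and a single point has no integral neutral centre; the first jump is estimated trivially.\<close>
lemma cyclic_variation_sum:
  fixes t :: "nat \<Rightarrow> nat"
  assumes F: "biperiodic F" and G: "biperiodic G" and t: "strict_mono_on {..m} t" "1 \<le> t 0"
  shows "(\<Sum>j = 1..m. sq_distance F G (t j) (t (j - 1))) \<le> 283116503 * (norm4 F + norm4 G)"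
proof (cases m)
  case 0 then show ?thesis by (simp add: norm4_nonneg)
next
  case (Suc n)
  let ?N = "norm4 F + norm4 G"
  define s where "s i = t (min (Suc i) m)" for i
  have ms: "mono s"
    unfolding s_def by (rule monoI) (auto intro!: strict_mono_on_leD[OF t(1)])
  have s2: "2 \<le> s i" for i
  proof -
    have "t 0 < t (min (Suc i) m)" by (rule strict_mono_onD[OF t(1)]) (use Suc in auto)
    then show ?thesis using t(2) by (simp add: s_def)
  qed
  have first: "sq_distance F G (t 1) (t 0) \<le> 2 * ?N"
  proof -
    have "sq_distance F G (t 1) (t 0) \<le> csum (\<lambda>x. csum (\<lambda>y. 2 * ((window_avg F G (t 1) 0 x y)\<^sup>2 + (window_avg F G (t 0) 0 x y)\<^sup>2)))"
    proof (intro csum_mono)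
      fix x y
      have "(a - b)\<^sup>2 \<le> 2 * (a\<^sup>2 + b\<^sup>2)" for a b :: real
        using zero_le_power2[of "a + b"] by (simp add: power2_eq_square algebra_simps)
      then show "(window_avg F G (t 1) 0 x y - window_avg F G (t 0) 0 x y)\<^sup>2 \<le> 2 * ((window_avg F G (t 1) 0 x y)\<^sup>2 + (window_avg F G (t 0) 0 x y)\<^sup>2)" .
    qed
    also have "\<dots> = 2 * (csum (\<lambda>x. csum (\<lambda>y. (window_avg F G (t 1) 0 x y)\<^sup>2)) + csum (\<lambda>x. csum (\<lambda>y. (window_avg F G (t 0) 0 x y)\<^sup>2)))"
      by (simp only: csum_cmult csum_add)
    also have "\<dots> \<le> 2 * (?N / 2 + ?N / 2)"
      by (intro mult_left_mono add_mono window_avg_square_le[OF F G]) auto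
    finally show ?thesis by simp
  qed
  have "(\<Sum>j = 1..m. sq_distance F G (t j) (t (j - 1))) = (\<Sum>i<Suc n. sq_distance F G (t (Suc i)) (t i))"
    unfolding Suc by (rule sum.reindex_bij_witness[of _ Suc "\<lambda>j. j - 1"]) auto
  also have "\<dots> = sq_distance F G (t 1) (t 0) + (\<Sum>i<n. sq_distance F G (t (Suc (Suc i))) (t (Suc i)))"
    by (subst sum.lessThan_Suc_shift) simp
  finally have split: "(\<Sum>j = 1..m. sq_distance F G (t j) (t (j - 1)))
      = sq_distance F G (t 1) (t 0) + (\<Sum>i<n. sq_distance F G (t (Suc (Suc i))) (t (Suc i)))" .
  have "(\<Sum>i<n. sq_distance F G (t (Suc (Suc i))) (t (Suc i))) = (\<Sum>i<n. sq_distance F G (s (Suc i)) (s i))"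
    by (rule sum.cong) (auto simp: s_def Suc)
  then have "(\<Sum>i<n. sq_distance F G (t (Suc (Suc i))) (t (Suc i))) \<le> 283116501 * ?N"
    using variation_from_two[OF F G ms s2, of n] by simp
  then show ?thesis unfolding split using first by argo
qed

end

section \<open>Transfer to the integer lattice\<close>

text \<open>The optimal choice is \<open>s = sqrt (b / a)\<close>; if \<open>a\<close> or \<open>b\<close> vanishes, letting \<open>s\<close> tend to infinity or to zero shows that \<open>L \<le> 0\<close>.\<close>
lemma balance_scaling:
  fixes L C a b :: real
  assumes le: "\<And>s. 0 < s \<Longrightarrow> L \<le> C * (s * a + b / s)" and C: "0 < C" and "0 \<le> a" "0 \<le> b"
  shows "L \<le> 2 * C * sqrt (a * b)"
proof (cases "a = 0 \<or> b = 0")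
  case False
  then have pos: "0 < a" "0 < b" using assms by auto
  define s where "s = sqrt (b / a)"
  have s: "0 < s" unfolding s_def using pos by simp
  have ss: "s * s = b / a" unfolding s_def using pos by simp
  have "s * a = sqrt (b / a) * sqrt (a * a)" unfolding s_def using pos by simp
  also have "\<dots> = sqrt (b / a * (a * a))" by (rule real_sqrt_mult[symmetric])
  also have "b / a * (a * a) = a * b" using pos by simp
  finally have sa: "s * a = sqrt (a * b)" .
  have "b = (s * s) * a" using ss pos by simp
  then have "b / s = s * a" using s by simp
  then show ?thesis using le[OF s] sa by simp
next
  case True
  have "L \<le> 0"
  proof (rule field_le_epsilon)
    fix e :: real assume e: "0 < e"
    show "L \<le> 0 + e"
    proof (cases "a = 0")
      case True
      have "C * (b / ((C * b + 1) / e)) = e * (C * b) / (C * b + 1)" by simp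
      also have "\<dots> \<le> e" using e C assms(4) by (simp add: divide_le_eq add_nonneg_pos mult_left_mono)
      finally show ?thesis using le[of "(C * b + 1) / e"] True e C assms(4)
        by (simp add: add_nonneg_pos)
    next
      case False
      then have b: "b = 0" using \<open>a = 0 \<or> b = 0\<close> by simp
      have a: "0 < a" using False assms(3) by simp
      have "C * (e / (C * a) * a) = e" using C a by simp
      then show ?thesis using le[of "e / (C * a)"] b e C a by simp
    qed
  qed
  then show ?thesis using True by auto
qed

text \<open>The representative of a residue class modulo \<open>2 * \<rho> + 1\<close> of least absolute value.\<close>
definition centred_residue :: "int \<Rightarrow> int \<Rightarrow> int" where
  "centred_residue \<rho> x = (x + \<rho>) mod (2 * \<rho> + 1) - \<rho>"

lemma centred_residue_id: "\<bar>x\<bar> \<le> \<rho> \<Longrightarrow> centred_residue \<rho> x = x"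
  by (simp add: centred_residue_def)

lemma centred_residue_add: "centred_residue \<rho> (x + (2 * \<rho> + 1)) = centred_residue \<rho> x"
proof -
  have "(x + (2 * \<rho> + 1) + \<rho>) mod (2 * \<rho> + 1) = (x + \<rho> + (2 * \<rho> + 1)) mod (2 * \<rho> + 1)"
    by (simp only: ac_simps)
  then show ?thesis unfolding centred_residue_def by (simp only: mod_add_self2)
qed

lemma centred_residue_diff: "centred_residue \<rho> (x - (2 * \<rho> + 1)) = centred_residue \<rho> x"
  using centred_residue_add[of \<rho> "x - (2 * \<rho> + 1)"] by (simp only: diff_add_cancel)

lemma (in cyclic_sum) csum_window:
  assumes "periodic f" "M = 2 * \<rho> + 1"
  shows "csum f = (\<Sum>x\<in>{-\<rho>..\<rho>}. f x)"
proof -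
  have "csum f = csum (\<lambda>x. f (x + (-\<rho>)))" by (rule csum_shift[OF assms(1), symmetric])
  also have "\<dots> = (\<Sum>x\<in>{-\<rho>..\<rho>}. f x)"
    unfolding csum_def by (rule sum.reindex_bij_witness[of _ "\<lambda>x. x + \<rho>" "\<lambda>x. x - \<rho>"]) (use assms(2) in auto)
  finally show ?thesis .
qed

lemma (in cyclic_sum) csum_square_window:
  assumes "\<And>x. periodic (h x)" "\<And>y. periodic (\<lambda>x. h x y)" "M = 2 * \<rho> + 1"
  shows "csum (\<lambda>x. csum (h x)) = (\<Sum>(x, y)\<in>{-\<rho>..\<rho>} \<times> {-\<rho>..\<rho>}. h x y)"
proof -
  have "periodic (\<lambda>x. csum (h x))" using assms(2) by (simp add: periodic_def csum_def)
  then show ?thesis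
    using csum_window[OF _ assms(3)] assms(1) by (simp add: sum.cartesian_product)
qed

abbreviation l4_sum :: "(int \<times> int \<Rightarrow> real) \<Rightarrow> real" where
  "l4_sum F \<equiv> (\<Sum>\<^sub>\<infinity>p. \<bar>F p\<bar> powr 4)"

lemma sum_power4_le_l4_sum:
  assumes "F \<in> lp_space 4" "finite X"
  shows "(\<Sum>p\<in>X. (F p) ^ 4) \<le> l4_sum F"
proof -
  have e: "(F p) ^ 4 = \<bar>F p\<bar> powr 4" for p
  proof -
    have "\<bar>F p\<bar> powr 4 = \<bar>F p\<bar> ^ 4" using powr_numeral[of "\<bar>F p\<bar>" "num.Bit0 (num.Bit0 num.One)"] by simp
    then show ?thesis by simp
  qed
  have s: "(\<lambda>p. \<bar>F p\<bar> powr 4) summable_on UNIV" using assms(1) by (simp add: lp_space_def)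
  show ?thesis unfolding e by (rule finite_sum_le_infsum[OF s assms(2)]) auto
qed

text \<open>Extending \<open>F\<close> and \<open>G\<close> periodically from a large square does not change the averages of length at most \<open>t m\<close> on the finite
set \<open>X\<close>, and does not increase the norms. The second estimate yields that the averages are square summable.\<close>
lemma finite_variation:
  fixes t :: "nat \<Rightarrow> nat"
  assumes F: "F \<in> lp_space 4" and G: "G \<in> lp_space 4" and X: "finite X"
    and t: "strict_mono_on {..m} t" "1 \<le> t 0"
  shows "(\<Sum>p\<in>X. \<Sum>j = 1..m. (discrete_avg (t j) F G p - discrete_avg (t (j - 1)) F G p)\<^sup>2)
      \<le> 283116503 * (l4_sum F + l4_sum G)" (is ?A)
    and "(\<Sum>p\<in>X. (discrete_avg (t 0) F G p)\<^sup>2) \<le> (l4_sum F + l4_sum G) / 2" (is ?B)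
proof -
  define r where "r = Max (insert 0 (abs ` (fst ` X \<union> snd ` X)))"
  have r: "\<bar>x\<bar> \<le> r" if "x \<in> fst ` X \<union> snd ` X" for x
    unfolding r_def by (rule Max_ge) (use X that in auto)
  \<comment> \<open>large enough that the windows used by the averages on \<open>X\<close> do not wrap around\<close>
  define \<rho> where "\<rho> = max r 0 + int (t m)"
  define M where "M = 2 * \<rho> + 1"
  interpret cyclic_sum M by unfold_locales (simp add: M_def \<rho>_def)
  define F1 where "F1 y z = F (centred_residue \<rho> (z - y), centred_residue \<rho> y)" for y z
  define G1 where "G1 x z = G (centred_residue \<rho> x, centred_residue \<rho> (z - x))" for x z
  have shifts: "centred_residue \<rho> (z + M - y) = centred_residue \<rho> (z - y)" "centred_residue \<rho> (z - (y + M)) = centred_residue \<rho> (z - y)"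
    "centred_residue \<rho> (y + M) = centred_residue \<rho> y" "centred_residue \<rho> (y + M + z) = centred_residue \<rho> (y + z)" for y z
    using centred_residue_add[of \<rho> "z - y"] centred_residue_diff[of \<rho> "z - y"] centred_residue_add[of \<rho> y] centred_residue_add[of \<rho> "y + z"]
    unfolding M_def by (simp_all only: algebra_simps)
  have pF: "biperiodic F1" and pG: "biperiodic G1"
    by (auto simp: biperiodic_def periodic_def F1_def G1_def fun_eq_iff shifts)
  have perNN: "periodic (\<lambda>x. H (centred_residue \<rho> x) ^ 4)" for H :: "int \<Rightarrow> real"
    by (simp add: periodic_def shifts)
  have NF: "norm4 F1 \<le> l4_sum F"
  proof -
    have "norm4 F1 = csum (\<lambda>x. csum (\<lambda>z. F (centred_residue \<rho> z, centred_residue \<rho> x) ^ 4))"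
      unfolding norm4_def F1_def
    proof (rule csum_cong)
      fix x
      show "csum (\<lambda>z. F (centred_residue \<rho> (z - x), centred_residue \<rho> x) ^ 4) = csum (\<lambda>z. F (centred_residue \<rho> z, centred_residue \<rho> x) ^ 4)"
        using csum_shift[OF perNN[of "\<lambda>z. F (z, centred_residue \<rho> x)"], of "- x"] by simp
    qed
    also have "\<dots> = (\<Sum>(x, z)\<in>{-\<rho>..\<rho>} \<times> {-\<rho>..\<rho>}. F (centred_residue \<rho> z, centred_residue \<rho> x) ^ 4)"
      by (rule csum_square_window) (simp_all add: periodic_def shifts M_def[symmetric])
    also have "\<dots> = (\<Sum>p\<in>{-\<rho>..\<rho>} \<times> {-\<rho>..\<rho>}. F p ^ 4)"
      by (rule sum.reindex_bij_witness[of _ "\<lambda>(x, y). (y, x)" "\<lambda>(x, y). (y, x)"]) (auto simp: centred_residue_id)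
    also have "\<dots> \<le> l4_sum F" by (rule sum_power4_le_l4_sum[OF F]) simp
    finally show ?thesis .
  qed
  have NG: "norm4 G1 \<le> l4_sum G"
  proof -
    have "norm4 G1 = csum (\<lambda>x. csum (\<lambda>z. G (centred_residue \<rho> x, centred_residue \<rho> z) ^ 4))"
      unfolding norm4_def G1_def
    proof (rule csum_cong)
      fix x
      show "csum (\<lambda>z. G (centred_residue \<rho> x, centred_residue \<rho> (z - x)) ^ 4) = csum (\<lambda>z. G (centred_residue \<rho> x, centred_residue \<rho> z) ^ 4)"
        using csum_shift[OF perNN[of "\<lambda>z. G (centred_residue \<rho> x, z)"], of "- x"] by simp
    qed
    also have "\<dots> = (\<Sum>(x, z)\<in>{-\<rho>..\<rho>} \<times> {-\<rho>..\<rho>}. G (centred_residue \<rho> x, centred_residue \<rho> z) ^ 4)"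
      by (rule csum_square_window) (simp_all add: periodic_def shifts M_def[symmetric])
    also have "\<dots> = (\<Sum>p\<in>{-\<rho>..\<rho>} \<times> {-\<rho>..\<rho>}. G p ^ 4)"
      by (rule sum.cong) (auto simp: centred_residue_id)
    also have "\<dots> \<le> l4_sum G" by (rule sum_power4_le_l4_sum[OF G]) simp
    finally show ?thesis .
  qed
  have window_avg: "window_avg F1 G1 n 0 x y = (\<Sum>z\<in>{0..<int n}. F (centred_residue \<rho> (x + z), centred_residue \<rho> y) * G (centred_residue \<rho> x, centred_residue \<rho> (y + z))) / real n"
    for n x y
  proof -
    have "x + y + z - y = x + z" "x + y + z - x = y + z" for z by auto
    then show ?thesis by (simp add: window_avg_def fibre_def F1_def G1_def)
  qed
  have pav: "periodic (window_avg F1 G1 n 0 x)" "periodic (\<lambda>x. window_avg F1 G1 n 0 x y)" for n x y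
    by (simp_all add: periodic_def window_avg shifts)
  have agree: "window_avg F1 G1 n 0 (fst p) (snd p) = discrete_avg n F G p" if p: "p \<in> X" and n: "n \<le> t m" for p n
  proof -
    obtain x y where xy: "p = (x, y)" by (cases p)
    have "x \<in> fst ` X \<union> snd ` X" "y \<in> fst ` X \<union> snd ` X" using p xy by force+
    then have b: "\<bar>x\<bar> \<le> r" "\<bar>y\<bar> \<le> r" using r by blast+
    have "(\<Sum>z\<in>{0..<int n}. F (centred_residue \<rho> (x + z), centred_residue \<rho> y) * G (centred_residue \<rho> x, centred_residue \<rho> (y + z)))
      = (\<Sum>i\<in>{0..<n}. F (x + int i, y) * G (x, y + int i))"
    proof (rule sum.reindex_bij_witness[of _ int nat])
      fix z assume z: "z \<in> {0..<int n}"
      then have "centred_residue \<rho> (x + z) = x + z" "centred_residue \<rho> (y + z) = y + z" "centred_residue \<rho> x = x" "centred_residue \<rho> y = y"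
        using b n by (auto intro!: centred_residue_id simp: \<rho>_def)
      then show "F (x + int (nat z), y) * G (x, y + int (nat z))
        = F (centred_residue \<rho> (x + z), centred_residue \<rho> y) * G (centred_residue \<rho> x, centred_residue \<rho> (y + z))" using z by simp
    qed auto
    then show ?thesis by (simp add: window_avg discrete_avg_def xy)
  qed
  have XW: "X \<subseteq> {-\<rho>..\<rho>} \<times> {-\<rho>..\<rho>}"
  proof
    fix p assume p: "p \<in> X"
    obtain x y where xy: "p = (x, y)" by (cases p)
    have "x \<in> fst ` X \<union> snd ` X" "y \<in> fst ` X \<union> snd ` X" using p xy by force+
    then have b: "\<bar>x\<bar> \<le> r" "\<bar>y\<bar> \<le> r" using r by blast+
    then show "p \<in> {-\<rho>..\<rho>} \<times> {-\<rho>..\<rho>}" unfolding xy \<rho>_def by auto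
  qed
  have X_le: "(\<Sum>p\<in>X. h (fst p) (snd p)) \<le> csum (\<lambda>x. csum (h x))"
    if "\<And>x. periodic (h x)" "\<And>y. periodic (\<lambda>x. h x y)" "\<And>x y. 0 \<le> h x y" for h
  proof -
    have "(\<Sum>p\<in>X. h (fst p) (snd p)) \<le> (\<Sum>p\<in>{-\<rho>..\<rho>} \<times> {-\<rho>..\<rho>}. h (fst p) (snd p))"
      by (rule sum_mono2) (use XW that(3) in auto)
    also have "\<dots> = csum (\<lambda>x. csum (h x))"
      using csum_square_window[of h \<rho>] that(1,2) by (simp add: M_def case_prod_unfold)
    finally show ?thesis .
  qed
  have tm: "t j \<le> t m" if "j \<le> m" for j
    using that by (intro strict_mono_on_leD[OF t(1)]) auto
  have "(\<Sum>p\<in>X. \<Sum>j = 1..m. (discrete_avg (t j) F G p - discrete_avg (t (j - 1)) F G p)\<^sup>2)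
     = (\<Sum>j = 1..m. \<Sum>p\<in>X. (window_avg F1 G1 (t j) 0 (fst p) (snd p) - window_avg F1 G1 (t (j - 1)) 0 (fst p) (snd p))\<^sup>2)"
  proof (subst sum.swap, intro sum.cong refl)
    fix j p assume j: "j \<in> {1..m}" and p: "p \<in> X"
    then have "t j \<le> t m" "t (j - 1) \<le> t m" by (auto intro!: tm)
    then show "(discrete_avg (t j) F G p - discrete_avg (t (j - 1)) F G p)\<^sup>2
       = (window_avg F1 G1 (t j) 0 (fst p) (snd p) - window_avg F1 G1 (t (j - 1)) 0 (fst p) (snd p))\<^sup>2"
      using agree[OF p] by simp
  qed
  also have "\<dots> \<le> (\<Sum>j = 1..m. sq_distance F1 G1 (t j) (t (j - 1)))"
  proof (rule sum_mono)
    fix j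
    show "(\<Sum>p\<in>X. (window_avg F1 G1 (t j) 0 (fst p) (snd p) - window_avg F1 G1 (t (j - 1)) 0 (fst p) (snd p))\<^sup>2)
       \<le> sq_distance F1 G1 (t j) (t (j - 1))"
      by (rule X_le) (use pav in \<open>auto simp: periodic_def\<close>)
  qed
  also have "\<dots> \<le> 283116503 * (norm4 F1 + norm4 G1)"
    by (rule cyclic_variation_sum[OF pF pG t])
  finally show ?A using NF NG by simp
  have "(\<Sum>p\<in>X. (discrete_avg (t 0) F G p)\<^sup>2) = (\<Sum>p\<in>X. (window_avg F1 G1 (t 0) 0 (fst p) (snd p))\<^sup>2)"
    by (intro sum.cong refl) (simp add: agree tm)
  also have "\<dots> \<le> csum (\<lambda>x. csum (\<lambda>y. (window_avg F1 G1 (t 0) 0 x y)\<^sup>2))"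
    by (rule X_le) (use pav in \<open>auto simp: periodic_def\<close>)
  also have "\<dots> \<le> (norm4 F1 + norm4 G1) / 2" by (rule window_avg_square_le[OF pF pG])
  finally show ?B using NF NG by simp
qed

lemma abs_powr_2: "\<bar>x\<bar> powr 2 = x\<^sup>2" for x :: real
  by (simp add: powr_numeral[of "\<bar>x\<bar>" "num.Bit0 num.One", simplified])

lemma discrete_avg_in_l2:
  assumes F: "F \<in> lp_space 4" and G: "G \<in> lp_space 4" and n: "1 \<le> n"
  shows "(\<lambda>p. (discrete_avg n F G p)\<^sup>2) summable_on UNIV"
proof (rule nonneg_bdd_above_summable_on)
  show "bdd_above (sum (\<lambda>p. (discrete_avg n F G p)\<^sup>2) ` {X. X \<subseteq> UNIV \<and> finite X})"
  proof (rule bdd_aboveI2)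
    fix X :: "(int \<times> int) set" assume "X \<in> {X. X \<subseteq> UNIV \<and> finite X}"
    then have "finite X" by simp
    moreover have "strict_mono_on {..0::nat} (\<lambda>_. n)" by (rule strict_mono_onI) simp
    ultimately show "(\<Sum>p\<in>X. (discrete_avg n F G p)\<^sup>2) \<le> (l4_sum F + l4_sum G) / 2"
      using finite_variation(2)[OF F G, of X 0 "\<lambda>_. n"] n by blast
  qed
qed simp

text \<open>The invariance that turns the additive bound into the product of norms.\<close>
lemma discrete_avg_scale:
  "c \<noteq> 0 \<Longrightarrow> discrete_avg n (\<lambda>p. c * F p) (\<lambda>p. G p / c) = discrete_avg n F G"
  by (simp add: discrete_avg_def)

lemma l4_sum_scale:
  assumes F: "F \<in> lp_space 4" and c: "0 < c"
  shows "(\<lambda>p. c * F p) \<in> lp_space 4" "l4_sum (\<lambda>p. c * F p) = c ^ 4 * l4_sum F"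
proof -
  have "c powr 4 = c ^ 4" using powr_numeral[of c "num.Bit0 (num.Bit0 num.One)"] c by simp
  then have e: "\<bar>c * F p\<bar> powr 4 = c ^ 4 * \<bar>F p\<bar> powr 4" for p
    using c by (simp add: abs_mult powr_mult)
  show "(\<lambda>p. c * F p) \<in> lp_space 4"
    using F unfolding lp_space_def mem_Collect_eq e by (rule summable_on_cmult_right)
  show "l4_sum (\<lambda>p. c * F p) = c ^ 4 * l4_sum F"
    unfolding e by (rule infsum_cmult_right') 
qed

lemma finite_variation_product:
  fixes t :: "nat \<Rightarrow> nat"
  assumes F: "F \<in> lp_space 4" and G: "G \<in> lp_space 4" and X: "finite X"
    and t: "strict_mono_on {..m} t" "1 \<le> t 0"
  shows "(\<Sum>p\<in>X. \<Sum>j = 1..m. (discrete_avg (t j) F G p - discrete_avg (t (j - 1)) F G p)\<^sup>2)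
      \<le> 2 * 283116503 * sqrt (l4_sum F * l4_sum G)"
proof (rule balance_scaling)
  fix s :: real assume s: "0 < s"
  define c where "c = sqrt (sqrt s)"
  have c: "0 < c" using s by (simp add: c_def)
  have c4: "c ^ 4 = s"
  proof -
    have "c ^ 4 = (c\<^sup>2)\<^sup>2" by simp
    then show ?thesis using s by (simp add: c_def)
  qed
  have d: "0 < 1 / c" using c by simp
  have e: "(\<lambda>p. G p / c) = (\<lambda>p. (1 / c) * G p)" by auto
  show "(\<Sum>p\<in>X. \<Sum>j = 1..m. (discrete_avg (t j) F G p - discrete_avg (t (j - 1)) F G p)\<^sup>2)
      \<le> 283116503 * (s * l4_sum F + l4_sum G / s)"
    using finite_variation(1)[OF l4_sum_scale(1)[OF F c] l4_sum_scale(1)[OF G d] X t]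
    unfolding l4_sum_scale(2)[OF F c] l4_sum_scale(2)[OF G d] e[symmetric] discrete_avg_scale[OF less_imp_neq[OF c, symmetric]]
    using c4 by (simp add: power_divide)
qed (auto intro!: infsum_nonneg)

lemma lp_norm_4: "sqrt (sqrt (l4_sum H)) = lp_norm 4 H"
proof -
  have "0 \<le> l4_sum H" by (intro infsum_nonneg) simp
  then show ?thesis by (simp add: lp_norm_def powr_half_sqrt[symmetric] powr_powr)
qed

lemma has_sum_finite_sum:
  fixes f :: "'i \<Rightarrow> 'a \<Rightarrow> real"
  assumes "finite I" "\<And>i. i \<in> I \<Longrightarrow> f i summable_on A"
  shows "((\<lambda>x. \<Sum>i\<in>I. f i x) has_sum (\<Sum>i\<in>I. infsum (f i) A)) A"
  using assms by (induction I rule: finite_induct) (auto intro!: has_sum_add)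

theorem corollary4:
  "\<exists>C::real. C \<ge> 0 \<and>
     (\<forall>F \<in> lp_space 4. \<forall>G \<in> lp_space 4.
        (\<forall>n \<ge> 1. discrete_avg n F G \<in> lp_space 2) \<and>
        variation (lp_norm 2) 2 {1::nat..} (\<lambda>n. discrete_avg n F G)
          \<le> ennreal (C * lp_norm 4 F * lp_norm 4 G))"
proof (intro exI conjI ballI allI impI)
  let ?C = "sqrt (2 * 283116503) :: real"
  show "0 \<le> ?C" by simp
  fix F G :: "int \<times> int \<Rightarrow> real" assume F: "F \<in> lp_space 4" and G: "G \<in> lp_space 4"
  show "discrete_avg n F G \<in> lp_space 2" if "1 \<le> n" for n
    using discrete_avg_in_l2[OF F G that] by (simp add: lp_space_def abs_powr_2)
  show "variation (lp_norm 2) 2 {1::nat..} (\<lambda>n. discrete_avg n F G)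
          \<le> ennreal (?C * lp_norm 4 F * lp_norm 4 G)"
    unfolding variation_def
  proof (rule SUP_least, clarify)
    fix m :: nat and t :: "nat \<Rightarrow> nat"
    assume tU: "t ` {..m} \<subseteq> {1..}" and t: "strict_mono_on {..m} t"
    have t0: "1 \<le> t 0" using tU by auto
    have t1: "1 \<le> t j" if "j \<le> m" for j using tU that by auto
    define d where "d j p = discrete_avg (t j) F G p - discrete_avg (t (j - 1)) F G p" for j p
    have sd: "(\<lambda>p. (d j p)\<^sup>2) summable_on UNIV" if "j \<in> {1..m}" for j
    proof (rule summable_on_comparison_test)
      show "(\<lambda>p. 2 * (discrete_avg (t j) F G p)\<^sup>2 + 2 * (discrete_avg (t (j - 1)) F G p)\<^sup>2) summable_on UNIV"
        by (intro summable_on_add summable_on_cmult_right discrete_avg_in_l2[OF F G] t1) (use that in auto)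
      fix p
      have "(a - b)\<^sup>2 \<le> 2 * a\<^sup>2 + 2 * b\<^sup>2" for a b :: real
        using zero_le_power2[of "a + b"] by (simp add: power2_eq_square algebra_simps)
      then show "(d j p)\<^sup>2 \<le> 2 * (discrete_avg (t j) F G p)\<^sup>2 + 2 * (discrete_avg (t (j - 1)) F G p)\<^sup>2"
        unfolding d_def .
    qed simp
    have N: "lp_norm 2 (discrete_avg (t j) F G - discrete_avg (t (j - 1)) F G) powr 2 = (\<Sum>\<^sub>\<infinity>p. (d j p)\<^sup>2)" for j
    proof -
      have "0 \<le> (\<Sum>\<^sub>\<infinity>p. (d j p)\<^sup>2)" by (intro infsum_nonneg) simp
      then show ?thesis by (simp add: lp_norm_def abs_powr_2 d_def powr_powr)
    qed
    have "(\<Sum>j = 1..m. lp_norm 2 (discrete_avg (t j) F G - discrete_avg (t (j - 1)) F G) powr 2)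
       = (\<Sum>\<^sub>\<infinity>p. \<Sum>j = 1..m. (d j p)\<^sup>2)"
      unfolding N by (rule infsumI[OF has_sum_finite_sum, symmetric]) (use sd in auto)
    also have "\<dots> \<le> 2 * 283116503 * sqrt (l4_sum F * l4_sum G)"
    proof (rule infsum_le_finite_sums)
      show "(\<lambda>p. \<Sum>j = 1..m. (d j p)\<^sup>2) summable_on UNIV"
        by (rule has_sum_imp_summable[OF has_sum_finite_sum]) (use sd in auto)
      show "(\<Sum>p\<in>X. \<Sum>j = 1..m. (d j p)\<^sup>2) \<le> 2 * 283116503 * sqrt (l4_sum F * l4_sum G)" if "finite X" for X
        unfolding d_def by (rule finite_variation_product[OF F G that t t0])
    qed
    finally have le: "(\<Sum>j = 1..m. lp_norm 2 (discrete_avg (t j) F G - discrete_avg (t (j - 1)) F G) powr 2)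
       \<le> 2 * 283116503 * sqrt (l4_sum F * l4_sum G)" .
    have n0: "0 \<le> l4_sum F" "0 \<le> l4_sum G" by (auto intro!: infsum_nonneg)
    have "(\<Sum>j = 1..m. lp_norm 2 (discrete_avg (t j) F G - discrete_avg (t (j - 1)) F G) powr 2) powr (1 / 2)
       \<le> (2 * 283116503 * sqrt (l4_sum F * l4_sum G)) powr (1 / 2)"
      by (rule powr_mono2) (use le in \<open>auto intro: sum_nonneg\<close>)
    also have "\<dots> = ?C * (sqrt (sqrt (l4_sum F)) * sqrt (sqrt (l4_sum G)))"
      using n0 by (simp add: powr_half_sqrt real_sqrt_mult)
    also have "\<dots> = ?C * (lp_norm 4 F * lp_norm 4 G)" unfolding lp_norm_4 ..
    finally show "ennreal ((\<Sum>j = 1..m. lp_norm 2 (discrete_avg (t j) F G - discrete_avg (t (j - 1)) F G) powr 2) powr (1 / 2))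
       \<le> ennreal (?C * lp_norm 4 F * lp_norm 4 G)"
      by (intro ennreal_leI) (simp only: mult.assoc)
  qed
qed

end
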